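(* There exists an uncountable dense subgroup $G$ of the compact group $\mathbb{T}^{\mathfrak{c}}$ (with $G$ carrying the subspace topology) such that every countable subgroup of $G$ is $h$-embedded in $G$ and closed in $G$, and every uncountable subgroup of $G$ is dense in $G$. Hence every quotient group of $G$ is either trivial or non-separable.
   Context: All topological groups are assumed to be Hausdorff. $\mathbb{T}$ is the circle group with its usual compact topology and $\mathfrak{c}=2^{\omega}$; $\mathbb{T}^{\mathfrak{c}}$ carries the product topology. A subgroup $S$ of an abelian topological group $G$ is $h$-embedded in $G$ if every (not necessarily continuous) homomorphism $f\colon S\to\mathbb{T}$ extends to a continuous homomorphism $G\to\mathbb{T}$. A quotient group of a topological group $G$ means $G/N$ with the quotient topology, where $N$ is a closed normal subgroup of $G$ (the case $N=\{e\}$ is allowed). A group is trivial if it has exactly one element; a space is separable if it has a countable dense subset. *)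

theory Defs
  imports "HOL-Analysis.Analysis" "HOL-Algebra.Product_Groups"
begin

definition circle_group :: "complex monoid" where
  "circle_group = \<lparr>carrier = sphere 0 1, monoid.mult = (*), one = 1\<rparr>"

definition circle_topology :: "complex topology" where
  "circle_topology = top_of_set (sphere 0 1)"

(* T^I; the power T^c with c = 2^omega is the case I = (UNIV :: nat set set), an index set
   of cardinality exactly 2^omega. *)
definition torus :: "'i set \<Rightarrow> ('i \<Rightarrow> complex) monoid" where
  "torus I = product_group I (\<lambda>_. circle_group)"

definition torus_topology :: "'i set \<Rightarrow> ('i \<Rightarrow> complex) topology" where
  "torus_topology I = product_topology (\<lambda>_. circle_topology) I"

(* A topological group is a pair (G, X) of a group and a topology on its carrier;
   as is customary for topological groups here, Hausdorffness is part of the notion. *)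
definition topological_group :: "('a, 'b) monoid_scheme \<Rightarrow> 'a topology \<Rightarrow> bool" where
  "topological_group G X \<longleftrightarrow>
     group G \<and> topspace X = carrier G \<and> Hausdorff_space X \<and>
     continuous_map (prod_topology X X) X (\<lambda>(x, y). x \<otimes>\<^bsub>G\<^esub> y) \<and>
     continuous_map X X (\<lambda>x. inv\<^bsub>G\<^esub> x)"

definition dense_in :: "'a set \<Rightarrow> 'a topology \<Rightarrow> bool" where
  "dense_in S X \<longleftrightarrow> S \<subseteq> topspace X \<and> X closure_of S = topspace X"

(* The homomorphism f on S is arbitrary; only its extension g has to be continuous. *)
definition h_embedded :: "'a set \<Rightarrow> ('a, 'b) monoid_scheme \<Rightarrow> 'a topology \<Rightarrow> bool" where
  "h_embedded S G X \<longleftrightarrow>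
     subgroup S G \<and>
     (\<forall>f \<in> hom (G\<lparr>carrier := S\<rparr>) circle_group.
        \<exists>g \<in> hom G circle_group.
          continuous_map X circle_topology g \<and> (\<forall>x\<in>S. g x = f x))"

(* The topology on G Mod N (whose points are the cosets N #> x): a set of cosets is open
   iff its preimage under the canonical projection is open. *)
definition quotient_group_topology ::
    "('a, 'b) monoid_scheme \<Rightarrow> 'a topology \<Rightarrow> 'a set \<Rightarrow> 'a set topology" where
  "quotient_group_topology G X N =
     topology (\<lambda>U. U \<subseteq> carrier (G Mod N) \<and> openin X {x \<in> topspace X. N #>\<^bsub>G\<^esub> x \<in> U})"

lemma openin_quotient_group_topology:
  "openin (quotient_group_topology G X N) U \<longleftrightarrow>
     U \<subseteq> carrier (G Mod N) \<and> openin X {x \<in> topspace X. N #>\<^bsub>G\<^esub> x \<in> U}"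
proof -
  let ?L = "\<lambda>U. U \<subseteq> carrier (G Mod N) \<and> openin X {x \<in> topspace X. N #>\<^bsub>G\<^esub> x \<in> U}"
  have "istopology ?L"
    unfolding istopology_def
  proof (intro conjI allI impI)
    fix S T assume "?L S" "?L T"
    moreover have "{x \<in> topspace X. N #>\<^bsub>G\<^esub> x \<in> S \<inter> T} =
        {x \<in> topspace X. N #>\<^bsub>G\<^esub> x \<in> S} \<inter> {x \<in> topspace X. N #>\<^bsub>G\<^esub> x \<in> T}" by auto
    ultimately show "S \<inter> T \<subseteq> carrier (G Mod N)"
      and "openin X {x \<in> topspace X. N #>\<^bsub>G\<^esub> x \<in> S \<inter> T}"
      by auto
  next
    fix \<K> assume K: "\<forall>K\<in>\<K>. ?L K"
    then show "\<Union>\<K> \<subseteq> carrier (G Mod N)" by blast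
    have "{x \<in> topspace X. N #>\<^bsub>G\<^esub> x \<in> \<Union>\<K>} =
        (\<Union>K\<in>\<K>. {x \<in> topspace X. N #>\<^bsub>G\<^esub> x \<in> K})" by auto
    then show "openin X {x \<in> topspace X. N #>\<^bsub>G\<^esub> x \<in> \<Union>\<K>}"
      using K by auto
  qed
  then show ?thesis
    by (simp add: quotient_group_topology_def)
qed

lemma quotient_map_quotient_group_topology:
  assumes "topspace X = carrier G"
  shows "quotient_map X (quotient_group_topology G X N) (\<lambda>x. N #>\<^bsub>G\<^esub> x)"
proof -
  have "openin (quotient_group_topology G X N) (carrier (G Mod N))"
  proof -
    have "{x \<in> topspace X. N #>\<^bsub>G\<^esub> x \<in> carrier (G Mod N)} = topspace X"
      using assms by (auto simp: carrier_FactGroup)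
    then show ?thesis by (simp add: openin_quotient_group_topology)
  qed
  then have top: "topspace (quotient_group_topology G X N) = carrier (G Mod N)"
    by (metis openin_quotient_group_topology openin_subset openin_topspace subset_antisym)
  show ?thesis
    unfolding quotient_map_def top
    using assms by (auto simp: openin_quotient_group_topology carrier_FactGroup)
qed

lemma group_circle_group: "group circle_group"
proof (rule groupI)
  fix x assume "x \<in> carrier circle_group"
  then show "\<exists>y\<in>carrier circle_group. y \<otimes>\<^bsub>circle_group\<^esub> x = \<one>\<^bsub>circle_group\<^esub>"
    by (intro bexI[of _ "inverse x"]) (auto simp: circle_group_def norm_inverse intro!: left_inverse)
qed (auto simp: circle_group_def norm_mult)

lemma inv_circle_group:
  assumes "x \<in> carrier circle_group"
  shows "inv\<^bsub>circle_group\<^esub> x = inverse x"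
  by (rule group.inv_equality[OF group_circle_group])
     (use assms in \<open>auto simp: circle_group_def norm_inverse intro!: left_inverse\<close>)

lemma group_torus: "group (torus I)"
  by (simp add: torus_def group_circle_group)

lemma topspace_torus_topology: "topspace (torus_topology I) = carrier (torus I)"
  by (simp add: torus_def torus_topology_def circle_group_def circle_topology_def)

lemma compact_space_torus_topology: "compact_space (torus_topology I)"
  by (simp add: torus_topology_def circle_topology_def compact_space_product_topology
      compact_space_subtopology compact_imp_compactin_subtopology compactin_euclidean_iff)

lemma topological_group_torus: "topological_group (torus I) (torus_topology I)"
  unfolding topological_group_def
proof (intro conjI group_torus topspace_torus_topology)
  show "Hausdorff_space (torus_topology I)"
    by (simp add: torus_topology_def circle_topology_def Hausdorff_space_product_topology
        Hausdorff_space_subtopology)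
  let ?P = "prod_topology (torus_topology I) (torus_topology I)"
  have proj: "continuous_map (torus_topology I) euclidean (\<lambda>x. x i)" if "i \<in> I" for i
    using continuous_map_product_projection[OF that, of "\<lambda>_. circle_topology"]
    by (simp add: torus_topology_def circle_topology_def continuous_map_in_subtopology)
  have proj2: "continuous_map ?P euclidean (\<lambda>z. fst z i)"
      "continuous_map ?P euclidean (\<lambda>z. snd z i)" if "i \<in> I" for i
    using continuous_map_compose[OF continuous_map_fst proj[OF that], of "torus_topology I"]
      continuous_map_compose[OF continuous_map_snd proj[OF that], of "torus_topology I"]
    by (auto simp: o_def)
  have mult: "continuous_map (prod_topology euclidean euclidean) euclidean
      (\<lambda>z :: complex \<times> complex. fst z * snd z)"
    by (auto intro!: continuous_intros)
  have cmult: "continuous_map ?P euclidean (\<lambda>z. fst z i * snd z i)" if "i \<in> I" for i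
    using continuous_map_compose[OF continuous_map_pairedI[OF proj2[OF that]] mult]
    by (simp add: o_def)
  have car: "x i \<in> sphere 0 1" if "x \<in> topspace (torus_topology I)" "i \<in> I" for x i
    using that by (auto simp: torus_topology_def circle_topology_def PiE_iff)
  show "continuous_map ?P (torus_topology I) (\<lambda>(x, y). x \<otimes>\<^bsub>torus I\<^esub> y)"
    apply (subst (3) torus_topology_def)
    unfolding continuous_map_componentwise
    using cmult car
    by (auto simp: torus_def circle_group_def circle_topology_def case_prod_unfold
        continuous_map_in_subtopology norm_mult)
  have inv: "inv\<^bsub>torus I\<^esub> x = (\<lambda>i\<in>I. inverse (x i))" if "x \<in> topspace (torus_topology I)" for x
    using that unfolding topspace_torus_topology torus_def
    by (simp add: inv_product_group group_circle_group)
       (auto simp: PiE_iff inv_circle_group intro!: restrict_ext)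
  have cinv: "continuous_map (torus_topology I) euclidean (\<lambda>x. inverse (x i))" if "i \<in> I" for i
  proof -
    have "continuous_map (top_of_set (sphere 0 1)) euclidean (inverse :: complex \<Rightarrow> complex)"
      by (auto intro!: continuous_intros)
    moreover have "continuous_map (torus_topology I) (top_of_set (sphere 0 1)) (\<lambda>x. x i)"
      using proj[OF that] car that by (auto simp: continuous_map_in_subtopology)
    ultimately have "continuous_map (torus_topology I) euclidean (inverse \<circ> (\<lambda>x. x i))"
      by (rule continuous_map_compose[rotated])
    then show ?thesis by (simp add: o_def)
  qed
  have "continuous_map (torus_topology I) (torus_topology I) (\<lambda>x. \<lambda>i\<in>I. inverse (x i))"
    apply (subst (2) torus_topology_def)
    unfolding continuous_map_componentwise
    using cinv car
    by (auto simp: circle_topology_def continuous_map_in_subtopology norm_inverse)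
  then show "continuous_map (torus_topology I) (torus_topology I) (\<lambda>x. inv\<^bsub>torus I\<^esub> x)"
    by (rule continuous_map_eq) (simp add: inv)
qed

lemma topological_group_subgroup:
  assumes "topological_group G X" "subgroup S G"
  shows "topological_group (G\<lparr>carrier := S\<rparr>) (subtopology X S)"
proof -
  have G: "group G" and top: "topspace X = carrier G" and Haus: "Hausdorff_space X"
    and mult: "continuous_map (prod_topology X X) X (\<lambda>(x, y). x \<otimes>\<^bsub>G\<^esub> y)"
    and inv: "continuous_map X X (\<lambda>x. inv\<^bsub>G\<^esub> x)"
    using assms(1) by (auto simp: topological_group_def)
  have sub: "S \<subseteq> carrier G"
    using assms(2) by (rule subgroup.subset)
  have "continuous_map (prod_topology (subtopology X S) (subtopology X S)) (subtopology X S)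
      (\<lambda>(x, y). x \<otimes>\<^bsub>G\<^esub> y)"
    unfolding continuous_map_in_subtopology
    using continuous_map_from_subtopology[OF mult, of "S \<times> S"] subgroup.m_closed[OF assms(2)]
    by (auto simp: subtopology_Times)
  moreover have "continuous_map (subtopology X S) (subtopology X S) (\<lambda>x. inv\<^bsub>G\<^esub> x)"
    unfolding continuous_map_in_subtopology
    using continuous_map_from_subtopology[OF inv, of S] subgroup.m_inv_closed[OF assms(2)]
    by auto
  then have "continuous_map (subtopology X S) (subtopology X S) (\<lambda>x. inv\<^bsub>G\<lparr>carrier := S\<rparr>\<^esub> x)"
    by (rule continuous_map_eq) (simp add: group.m_inv_consistent[OF G assms(2)])
  ultimately show ?thesis
    using subgroup.subgroup_is_group[OF assms(2) G] sub top Haus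
    by (auto simp: topological_group_def Hausdorff_space_subtopology)
qed

end

theory Submission
  imports Defs "HOL-Library.Poly_Mapping"
begin

text \<open>
  Let \<open>H\<close> be the free abelian group on \<open>2\<^sup>\<omega>\<close> generators \<open>\<xi>\<close>. A coordinate \<open>\<alpha>\<close> of the torus is a
  character of \<open>H\<close>, given by the angles \<open>\<theta> \<alpha> \<xi>\<close> of the generators. There are only \<open>2\<^sup>\<omega>\<close> ways to
  prescribe angles on a countable set of generators, so each of them can be realised by some \<open>\<alpha>\<close>;
  all angles that are not prescribed are taken from one family of reals that is independent over the
  rationals together with 1. Then every character of a countable subgroup of \<open>H\<close>, after extension
  to \<open>H\<close> by divisibility of the circle, agrees with a coordinate on that subgroup; this gives
  h-embeddedness, and closedness because characters separate a subgroup from a point outside it.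
  On the other hand a nontrivial integer combination of coordinates is injective on the subgroup
  generated by all but countably many generators, hence has countable kernel. So an uncountable
  subgroup contains, for any finitely many coordinates, an element lying in none of the countably
  many kernels, and by Kronecker's theorem its multiples are dense in these coordinates.
\<close>

subsection \<open>Reals independent modulo the integers\<close>

text \<open>As in the proof that \<open>e\<close> is irrational: \<open>M!\<close> times the tail beyond \<open>M\<close> is an integer, and it
  tends to 0.\<close>
lemma bounded_factorial_series_in_Ints:
  fixes c :: "nat \<Rightarrow> int"
  assumes bound: "\<And>m. \<bar>c m\<bar> \<le> K" and int: "suminf (\<lambda>m. c m / fact m :: real) \<in> \<int>"
  shows "\<exists>M. \<forall>m\<ge>M. c m = 0"
proof -
  let ?f = "\<lambda>m. c m / fact m :: real"
  have K: "0 \<le> K" using bound[of 0] by linarith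
  have le: "norm (?f m) \<le> K * (1 / fact m)" for m
    using bound[of m] by (simp add: divide_right_mono flip: of_int_abs)
  have se: "summable (\<lambda>m. 1 / fact m :: real)" "suminf (\<lambda>m. 1 / fact m :: real) = exp 1"
    using exp_converges[of "1::real"] by (auto simp: sums_iff field_simps)
  have sf: "summable ?f"
    by (rule summable_comparison_test[OF _ summable_mult[OF se(1), of K]]) (use le in blast)
  define t where "t M = suminf (\<lambda>m. ?f (m + M))" for M
  have t_int: "fact M * t (Suc M) \<in> \<int>" for M
  proof -
    have *: "fact M * ?f m \<in> \<int>" if "m < Suc M" for m
    proof -
      have "(fact m :: int) dvd fact M" using that by (intro fact_dvd) auto
      then obtain d where "(fact M :: int) = fact m * d" by auto
      then have "(fact M :: real) = fact m * of_int d"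
        by (metis of_int_fact of_int_mult)
      then have "fact M * ?f m = of_int (d * c m)" by simp
      then show ?thesis by (metis Ints_of_int)
    qed
    have "fact M * t (Suc M) = fact M * suminf (\<lambda>m. ?f m) - (\<Sum>m<Suc M. fact M * ?f m)"
      unfolding t_def suminf_minus_initial_segment[OF sf] sum_distrib_left right_diff_distrib ..
    moreover have "(fact M :: real) \<in> \<int>" by (metis Ints_of_nat of_nat_fact)
    moreover have "(\<Sum>m<Suc M. fact M * ?f m) \<in> \<int>"
      by (rule Ints_sum) (use * in simp)
    ultimately show ?thesis using int by (simp only: Ints_diff Ints_mult)
  qed
  have t_small: "\<bar>fact M * t (Suc M)\<bar> \<le> K * exp 1 / Suc M" for M
  proof -
    have b: "norm (fact M * ?f (m + Suc M)) \<le> K / Suc M * (1 / fact m)" for m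
    proof -
      \<comment> \<open>\<open>(M + 1)! m!\<close> divides \<open>(m + M + 1)!\<close>, so after
        multiplication by \<open>M!\<close> each term of the tail is at most
        \<open>K / (M + 1)\<close> times \<open>1 / m!\<close>. Summing over \<open>m\<close> gives
        \<open>K e / (M + 1)\<close>.\<close>
      have "fact (Suc M) * fact m \<le> (fact (m + Suc M) :: nat)"
        by (metis add.commute fact_fact_dvd_fact dvd_imp_le fact_gt_zero)
      then have "real (fact (Suc M) * fact m) \<le> real (fact (m + Suc M))"
        by (rule of_nat_mono)
      then have "fact (Suc M) * fact m \<le> (fact (m + Suc M) :: real)"
        by (simp only: of_nat_mult of_nat_fact)
      then have "fact M * (1 / fact (m + Suc M)) \<le> fact M * (1 / (fact (Suc M) * fact m :: real))"
        by (intro mult_left_mono divide_left_mono) auto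
      also have "\<dots> = 1 / Suc M * (1 / fact m)" by simp
      finally have *: "fact M * (1 / fact (m + Suc M)) \<le> 1 / Suc M * (1 / fact m :: real)" .
      have "norm (fact M * ?f (m + Suc M)) \<le> fact M * (K * (1 / fact (m + Suc M)))"
        unfolding norm_mult using le[of "m + Suc M"] by (intro mult_mono) auto
      also have "\<dots> = K * (fact M * (1 / fact (m + Suc M)))" by simp
      also have "\<dots> \<le> K * (1 / Suc M * (1 / fact m))"
        using * K by (intro mult_left_mono) auto
      finally show ?thesis by simp
    qed
    have s: "summable (\<lambda>m. K / Suc M * (1 / fact m :: real))" by (rule summable_mult[OF se(1)])
    have sf': "summable (\<lambda>m. ?f (m + Suc M))" using sf by (subst summable_iff_shift)
    have "norm (suminf (\<lambda>m. fact M * ?f (m + Suc M))) \<le> suminf (\<lambda>m. K / Suc M * (1 / fact m))"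
      by (rule norm_suminf_le[OF b s]) 
    also have "\<dots> = K * exp 1 / Suc M" using suminf_mult[OF se(1), of "K / Suc M"] se(2) by simp
    also have "suminf (\<lambda>m. fact M * ?f (m + Suc M)) = fact M * t (Suc M)"
      unfolding t_def by (rule suminf_mult[OF sf'])
    finally show ?thesis by simp
  qed
  obtain M0 :: nat where M0: "K * exp 1 < M0" using reals_Archimedean2 by blast
  have t0: "t (Suc M) = 0" if "M \<ge> M0" for M
  proof -
    have "K * exp 1 < Suc M" using M0 that by linarith
    then have "K * exp 1 / Suc M < 1" by (simp add: divide_less_eq)
    with t_small[of M] have "\<bar>fact M * t (Suc M)\<bar> < 1" by linarith
    with t_int[of M] have "fact M * t (Suc M) = 0" by (meson Ints_nonzero_abs_less1)
    then show ?thesis by simp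
  qed
  \<comment> \<open>The tails starting at \<open>m\<close> and at \<open>m + 1\<close> both vanish,
    and they differ by the term at \<open>m\<close>. The bound is \<open>Suc M0\<close> because
    \<open>t0\<close> speaks of tails starting at a successor.\<close>
  have "c m = 0" if "m \<ge> Suc M0" for m
  proof -
    have "t m = 0" "t (Suc m) = 0" using t0[of "m - 1"] t0[of m] that by (cases m; simp)+
    moreover have "t m = t (Suc m) + ?f m"
      unfolding t_def suminf_minus_initial_segment[OF sf] by simp
    ultimately show ?thesis by simp
  qed
  then show ?thesis by blast
qed

text \<open>The codes of the initial segments of \<open>A\<close>: an almost disjoint family of sets of naturals.\<close>
definition branch :: "nat set \<Rightarrow> nat set" where
  "branch A = range (\<lambda>n. prod_encode (n, set_encode (A \<inter> {..<n})))"

lemma infinite_branch: "infinite (branch A)"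
  unfolding branch_def by (rule range_inj_infinite) (auto simp: inj_def)

text \<open>If \<open>p\<close> lies in exactly one of the two sets, their segments below
  \<open>n\<close> differ for every \<open>n > p\<close>. A code records \<open>n\<close> as well as
  the segment, so only codes with \<open>n \<le> p\<close> can be shared.\<close>

lemma finite_branch_Int:
  assumes "A \<noteq> B"
  shows "finite (branch A \<inter> branch B)"
proof -
  obtain p where p: "p \<in> A \<longleftrightarrow> p \<notin> B" using assms by auto
  have "branch A \<inter> branch B \<subseteq> (\<lambda>n. prod_encode (n, set_encode (A \<inter> {..<n}))) ` {..p}"
  proof
    fix m assume "m \<in> branch A \<inter> branch B"
    then obtain n where n: "m = prod_encode (n, set_encode (A \<inter> {..<n}))"
      "set_encode (A \<inter> {..<n}) = set_encode (B \<inter> {..<n})"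
      by (auto simp: branch_def)
    then have "A \<inter> {..<n} = B \<inter> {..<n}" by (simp add: set_encode_eq)
    with p have "\<not> p < n" by auto
    then show "m \<in> (\<lambda>n. prod_encode (n, set_encode (A \<inter> {..<n}))) ` {..p}"
      unfolding n(1) by (intro imageI) auto
  qed
  then show ?thesis by (rule finite_subset) auto
qed

definition branch_real :: "nat set \<Rightarrow> real" where
  "branch_real A = suminf (\<lambda>m. of_bool (m \<in> branch A) / fact m)"

text \<open>The combination is a series of bounded integers over factorials, so its integrality
  makes the coefficients vanish eventually. An infinite set that meets each of the other branches in
  a finite set has arbitrarily large elements of its own; at such an \<open>m\<close> the
  coefficient is \<open>k A\<close>.\<close>

lemma branch_real_independent:
  assumes J: "finite J" and int: "(\<Sum>A\<in>J. of_int (k A) * branch_real A) \<in> \<int>" and "A \<in> J"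
  shows "k A = 0"
proof -
  define c where "c m = (\<Sum>A\<in>J. k A * of_bool (m \<in> branch A))" for m
  have se: "summable (\<lambda>m. 1 / fact m :: real)"
    using exp_converges[of "1::real"] by (auto simp: sums_iff field_simps)
  have s: "summable (\<lambda>m. of_bool (m \<in> branch A) / fact m :: real)" for A
    by (rule summable_comparison_test[OF _ se]) (auto intro!: exI[of _ 0])
  have "(\<Sum>A\<in>J. of_int (k A) * branch_real A)
      = (\<Sum>A\<in>J. suminf (\<lambda>m. of_int (k A) * (of_bool (m \<in> branch A) / fact m)))"
    unfolding branch_real_def by (simp only: suminf_mult[OF s])
  also have "\<dots> = suminf (\<lambda>m. \<Sum>A\<in>J. of_int (k A) * (of_bool (m \<in> branch A) / fact m))"
    by (rule suminf_sum[symmetric]) (intro summable_mult s)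
  also have "\<dots> = suminf (\<lambda>m. c m / fact m)"
    by (simp add: c_def sum_divide_distrib)
  finally have "suminf (\<lambda>m. c m / fact m :: real) \<in> \<int>" using int by simp
  moreover have "\<bar>c m\<bar> \<le> (\<Sum>A\<in>J. \<bar>k A\<bar>)" for m
    unfolding c_def by (rule order_trans[OF sum_abs sum_mono]) auto
  ultimately obtain M where M: "\<And>m. m \<ge> M \<Longrightarrow> c m = 0"
    using bounded_factorial_series_in_Ints[of c "\<Sum>A\<in>J. \<bar>k A\<bar>"] by auto
  have fin: "finite ({..<M} \<union> (\<Union>B\<in>J - {A}. branch A \<inter> branch B))" (is "finite ?F")
    using J finite_branch_Int by (intro finite_UnI finite_UN_I) auto
  have "infinite (branch A - ?F)" using infinite_branch[of A] fin by (rule Diff_infinite_finite[rotated])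
  then obtain m where "m \<in> branch A - ?F" by (metis ex_in_conv finite.emptyI)
  then have m: "m \<in> branch A" "m \<ge> M" "\<And>B. B \<in> J - {A} \<Longrightarrow> m \<notin> branch B"
    by auto
  have "c m = k A + (\<Sum>B\<in>J - {A}. k B * of_bool (m \<in> branch B))"
    unfolding c_def by (subst sum.remove[OF J \<open>A \<in> J\<close>]) (simp add: m(1))
  also have "\<dots> = k A" using m(3) by simp
  finally show ?thesis using M m(2) by simp
qed

section \<open>Coding reals and sequences by sets of naturals\<close>

lemma ex_surj_nat_set_real: "\<exists>g :: nat set \<Rightarrow> real. surj g"
proof -
  \<comment> \<open>Rational cuts: take for \<open>A\<close> the codes of the rationals below
    \<open>r\<close>.\<close>
  have "\<exists>A. Sup ((\<lambda>n. real_of_rat (from_nat n)) ` A) = r" for r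
  proof -
    let ?A = "{n. real_of_rat (from_nat n) < r}"
    have "Sup ((\<lambda>n. real_of_rat (from_nat n)) ` ?A) = r"
    proof (rule cSup_eq_non_empty)
      show "(\<lambda>n. real_of_rat (from_nat n)) ` ?A \<noteq> {}"
        using of_rat_dense[of "r - 1" r] by (auto simp: image_iff) (metis from_nat_to_nat)
    next
      fix y assume y: "\<And>x. x \<in> (\<lambda>n. real_of_rat (from_nat n)) ` ?A \<Longrightarrow> x \<le> y"
      show "r \<le> y"
      proof (rule ccontr)
        assume "\<not> r \<le> y"
        then obtain q where "y < of_rat q" "of_rat q < r" using of_rat_dense[of y r] by auto
        moreover have "of_rat q \<in> (\<lambda>n. real_of_rat (from_nat n)) ` ?A"
          using \<open>of_rat q < r\<close> by (auto intro!: image_eqI[of _ _ "to_nat q"])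
        ultimately show False using y by fastforce
      qed
    qed auto
    then show ?thesis by blast
  qed
  then show ?thesis by (intro exI[of _ "\<lambda>A. Sup ((\<lambda>n. real_of_rat (from_nat n)) ` A)"]) (metis surjI)
qed

text \<open>Lets an index \<alpha> code any sequence of generators with prescribed angles. The
  sections \<open>s \<alpha> i\<close> of a set of coded pairs can be chosen freely: even ones serve
  as generators, odd ones name a real through \<open>g\<close>.\<close>

lemma ex_surj_nat_set_sequences: "\<exists>\<phi> :: nat set \<Rightarrow> nat \<Rightarrow> nat set \<times> real. surj \<phi>"
proof -
  obtain g :: "nat set \<Rightarrow> real" where g: "surj g" using ex_surj_nat_set_real by blast
  define s where "s \<alpha> i = {m. prod_encode (i, m) \<in> \<alpha>}" for \<alpha> i
  have s: "s {prod_encode (i, m) | i m. m \<in> T i} = T" for T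
    by (auto simp: s_def fun_eq_iff)
  have "\<exists>\<alpha>. F = (\<lambda>n. (s \<alpha> (2 * n), g (s \<alpha> (2 * n + 1))))" for F
  proof -
    define T where "T i = (if even i then fst (F (i div 2)) else inv_into UNIV g (snd (F (i div 2))))" for i
    let ?\<alpha> = "{prod_encode (i, m) | i m. m \<in> T i}"
    have "F = (\<lambda>n. (T (2 * n), g (T (2 * n + 1))))"
      by (simp add: T_def surj_f_inv_f[OF g])
    then have "F = (\<lambda>n. (s ?\<alpha> (2 * n), g (s ?\<alpha> (2 * n + 1))))" by (simp only: s)
    then show ?thesis by blast
  qed
  then show ?thesis
    unfolding surj_def by (intro exI[of _ "\<lambda>\<alpha> n. (s \<alpha> (2 * n), g (s \<alpha> (2 * n + 1)))"]) blast
qed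

subsection \<open>Generic angles\<close>

text \<open>The finitely supported functions \<open>'a \<Rightarrow>\<^sub>0 int\<close> are the
  free abelian group on \<open>'a\<close>, and this is the additive extension to it of a map
  \<open>r\<close> on the generators.\<close>

definition pairing :: "('a \<Rightarrow> real) \<Rightarrow> ('a \<Rightarrow>\<^sub>0 int) \<Rightarrow> real" where
  "pairing r x = (\<Sum>\<xi>\<in>Poly_Mapping.keys x. of_int (Poly_Mapping.lookup x \<xi>) * r \<xi>)"

lemma pairing_superset:
  assumes "finite K" "Poly_Mapping.keys x \<subseteq> K"
  shows "pairing r x = (\<Sum>\<xi>\<in>K. of_int (Poly_Mapping.lookup x \<xi>) * r \<xi>)"
  unfolding pairing_def by (rule sum.mono_neutral_left) (use assms in \<open>auto simp: in_keys_iff\<close>)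

lemma pairing_cong:
  assumes "\<And>\<xi>. \<xi> \<in> Poly_Mapping.keys x \<Longrightarrow> r \<xi> = s \<xi>"
  shows "pairing r x = pairing s x"
  unfolding pairing_def by (rule sum.cong) (use assms in auto)

lemma pairing_diff: "pairing r (x - y) = pairing r x - pairing r y"
proof -
  let ?K = "Poly_Mapping.keys x \<union> Poly_Mapping.keys y"
  have "finite ?K" "Poly_Mapping.keys (x - y) \<subseteq> ?K" by (auto dest: keys_diff[THEN subsetD])
  then show ?thesis
    by (simp add: pairing_superset[of ?K] lookup_minus left_diff_distrib flip: sum_subtractf)
qed

lemma pairing_zero [simp]: "pairing r 0 = 0"
  by (simp add: pairing_def)

lemma pairing_uminus: "pairing r (- x) = - pairing r x"
  using pairing_diff[of r 0 x] by simp

lemma pairing_add: "pairing r (x + y) = pairing r x + pairing r y"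
  using pairing_diff[of r x "- y"] by (simp add: pairing_uminus)

lemma pairing_frag_of [simp]: "pairing r (frag_of a) = r a"
  by (simp add: pairing_def)

lemma pairing_frag_cmul: "pairing r (frag_cmul k x) = of_int k * pairing r x"
proof -
  have "pairing r (frag_cmul k x) = (\<Sum>\<xi>\<in>Poly_Mapping.keys x. of_int (k * Poly_Mapping.lookup x \<xi>) * r \<xi>)"
    by (subst pairing_superset[of "Poly_Mapping.keys x"]) (auto dest: keys_cmul[THEN subsetD])
  then show ?thesis by (simp add: pairing_def sum_distrib_left mult.assoc)
qed

text \<open>All that the construction of the group uses about the angles. They count modulo 1, so
  the sum is an integer exactly when the corresponding product of powers of coordinates has value 1
  at \<open>x\<close>.\<close>

locale generic_angles =
  fixes \<theta> :: "'i \<Rightarrow> 'a \<Rightarrow> real"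
  assumes interpolation: "countable C \<Longrightarrow> \<exists>\<alpha>. \<forall>\<xi>\<in>C. \<theta> \<alpha> \<xi> = r \<xi>"
    and countable_kernel: "\<lbrakk>finite J; \<alpha> \<in> J; k \<alpha> \<noteq> (0::int)\<rbrakk> \<Longrightarrow>
      countable {x. (\<Sum>\<alpha>\<in>J. of_int (k \<alpha>) * pairing (\<theta> \<alpha>) x) \<in> \<int>}"

text \<open>Let \<open>D\<close> be the countable set of generators at which some coordinate in
  \<open>J\<close> may fail to be generic. Two kernel elements that agree on \<open>D\<close> have a
  difference supported where all angles are independent, and such a difference is 0. So a kernel
  element is determined by its finite part over \<open>D\<close>.\<close>

lemma countable_kernel_of_independent_tail:
  fixes \<theta> :: "'i \<Rightarrow> 'a \<Rightarrow> real" and \<beta> :: "'i \<times> 'a \<Rightarrow> real"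
  assumes indep: "\<And>J k i. \<lbrakk>finite J; (\<Sum>i\<in>J. of_int (k i) * \<beta> i) \<in> \<int>; i \<in> J\<rbrakk> \<Longrightarrow> k i = (0::int)"
    and tail: "\<And>\<alpha> \<xi>. \<xi> \<notin> C \<alpha> \<Longrightarrow> \<theta> \<alpha> \<xi> = \<beta> (\<alpha>, \<xi>)" and C: "\<And>\<alpha>. countable (C \<alpha>)"
    and J: "finite J" "\<alpha> \<in> J" "k \<alpha> \<noteq> (0::int)"
  shows "countable {x. (\<Sum>\<alpha>\<in>J. of_int (k \<alpha>) * pairing (\<theta> \<alpha>) x) \<in> \<int>}"
    (is "countable ?Ker")
proof -
  define D where "D = (\<Union>\<alpha>\<in>J. C \<alpha>)"
  have D: "countable D" unfolding D_def using J(1) C by (intro countable_UN) (auto simp: countable_finite)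
  define part where "part x = (\<lambda>\<xi>. (\<xi>, Poly_Mapping.lookup x \<xi>)) ` (Poly_Mapping.keys x \<inter> D)" for x :: "'a \<Rightarrow>\<^sub>0 int"
  have "part ` ?Ker \<subseteq> {F. finite F \<and> F \<subseteq> D \<times> UNIV}"
    by (auto simp: part_def)
  moreover have "countable {F. finite F \<and> F \<subseteq> D \<times> (UNIV :: int set)}"
    using D by (intro countable_Collect_finite_subset) auto
  ultimately have "countable (part ` ?Ker)" by (rule countable_subset)
  moreover have "inj_on part ?Ker"
  proof (rule inj_onI)
    fix x y assume x: "x \<in> ?Ker" and y: "y \<in> ?Ker" and eq: "part x = part y"
    define z where "z = x - y"
    have "Poly_Mapping.lookup x \<xi> = Poly_Mapping.lookup y \<xi>" if "\<xi> \<in> D" for \<xi>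
    proof -
      have "(\<xi>, v) \<in> part u \<longleftrightarrow> v = Poly_Mapping.lookup u \<xi> \<and> v \<noteq> 0" for v and u :: "'a \<Rightarrow>\<^sub>0 int"
        using that by (auto simp: part_def in_keys_iff)
      then show ?thesis using eq by metis
    qed
    then have disj: "\<xi> \<notin> D" if "\<xi> \<in> Poly_Mapping.keys z" for \<xi>
      using that by (auto simp: z_def in_keys_iff lookup_minus)
    have "(\<Sum>\<alpha>\<in>J. of_int (k \<alpha>) * pairing (\<theta> \<alpha>) z)
       = (\<Sum>\<alpha>\<in>J. of_int (k \<alpha>) * pairing (\<theta> \<alpha>) x) - (\<Sum>\<alpha>\<in>J. of_int (k \<alpha>) * pairing (\<theta> \<alpha>) y)"
      by (simp add: z_def pairing_diff right_diff_distrib sum_subtractf)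
    then have "(\<Sum>\<alpha>\<in>J. of_int (k \<alpha>) * pairing (\<theta> \<alpha>) z) \<in> \<int>"
      using x y by auto
    also have "(\<Sum>\<alpha>\<in>J. of_int (k \<alpha>) * pairing (\<theta> \<alpha>) z)
       = (\<Sum>\<alpha>\<in>J. of_int (k \<alpha>) * pairing (\<lambda>\<xi>. \<beta> (\<alpha>, \<xi>)) z)"
      using disj tail by (intro sum.cong arg_cong2[of _ _ _ _ "(*)"] pairing_cong) (auto simp: D_def)
    \<comment> \<open>The angles of distinct pairs are distinct members of one independent family,
      so every product \<open>k \<alpha> * lookup z \<xi>\<close> must vanish; the given \<alpha>
      has \<open>k \<alpha> \<noteq> 0\<close>.\<close>
    also have "\<dots> = (\<Sum>(\<alpha>, \<xi>)\<in>J \<times> Poly_Mapping.keys z.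
        of_int (k \<alpha> * Poly_Mapping.lookup z \<xi>) * \<beta> (\<alpha>, \<xi>))"
      by (simp add: pairing_def sum_distrib_left sum.cartesian_product mult.assoc)
    finally have *: "(\<Sum>i\<in>J \<times> Poly_Mapping.keys z.
        of_int (k (fst i) * Poly_Mapping.lookup z (snd i)) * \<beta> i) \<in> \<int>"
      by (simp add: case_prod_unfold)
    have "Poly_Mapping.keys z = {}"
    proof (rule equals0I)
      fix \<xi> assume "\<xi> \<in> Poly_Mapping.keys z"
      then have "k \<alpha> * Poly_Mapping.lookup z \<xi> = 0"
        using indep[OF _ *, of "(\<alpha>, \<xi>)"] J by simp
      with J(3) \<open>\<xi> \<in> Poly_Mapping.keys z\<close> show False by (simp add: in_keys_iff)
    qed
    then show "x = y" by (simp add: z_def)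
  qed
  ultimately show ?thesis by (rule countable_image_inj_on)
qed

lemma ex_generic_angles: "\<exists>\<theta> :: nat set \<Rightarrow> nat set \<Rightarrow> real. generic_angles \<theta>"
proof -
  obtain \<phi> :: "nat set \<Rightarrow> nat \<Rightarrow> nat set \<times> real" where \<phi>: "surj \<phi>"
    using ex_surj_nat_set_sequences by blast
  \<comment> \<open>Turns a pair of index and generator into one set, so that
    \<open>branch_real\<close> supplies a separate independent real for each pair.\<close>
  define pair :: "nat set \<times> nat set \<Rightarrow> nat set" where "pair = (\<lambda>(A, B). sum_encode ` (A <+> B))"
  have "inj pair"
  proof (rule injI)
    fix p q assume "pair p = pair q"
    then have "fst p <+> snd p = fst q <+> snd q"
      by (simp add: pair_def case_prod_unfold inj_image_eq_iff[OF inj_sum_encode])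
    moreover have "Inl -` (A <+> B) = A" "Inr -` (A <+> B) = B" for A B :: "nat set" by auto
    ultimately have "fst p = fst q" "snd p = snd q" by metis+
    then show "p = q" by (rule prod_eqI)
  qed
  \<comment> \<open>\<open>C \<alpha>\<close> collects the generators whose angle is prescribed by
    the sequence \<open>\<phi> \<alpha>\<close>. If a generator is listed repeatedly,
    \<open>SOME\<close> settles on one of the entries.\<close>
  define C where "C \<alpha> = range (fst \<circ> \<phi> \<alpha>)" for \<alpha>
  define \<theta> where "\<theta> \<alpha> \<xi> = (if \<xi> \<in> C \<alpha> then snd (\<phi> \<alpha> (SOME n. fst (\<phi> \<alpha> n) = \<xi>))
    else branch_real (pair (\<alpha>, \<xi>)))" for \<alpha> \<xi>
  have "generic_angles \<theta>"
  proof
    fix S :: "nat set set" and r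
    assume S: "countable S"
    \<comment> \<open>Inserting \<open>{}\<close> provides a nonempty set to enumerate even if
      \<open>S\<close> is empty.\<close>
    define c where "c = from_nat_into (insert {} S)"
    have c: "range c = insert {} S"
      unfolding c_def using S by (intro range_from_nat_into) auto
    \<comment> \<open>The angle listed at \<open>n\<close> depends on \<open>c n\<close> alone, so
      whichever index \<open>SOME\<close> picks yields \<open>r \<xi>\<close>.\<close>
    obtain \<alpha> where \<alpha>: "\<phi> \<alpha> = (\<lambda>n. (c n, r (c n)))" using surjD[OF \<phi>] by metis
    have "\<theta> \<alpha> \<xi> = r \<xi>" if "\<xi> \<in> S" for \<xi>
    proof -
      have "\<xi> \<in> range c" using c that by simp
      then obtain n where n: "c n = \<xi>" by blast
      then have "c (SOME n. c n = \<xi>) = \<xi>" by (rule someI)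
      moreover have "\<xi> \<in> C \<alpha>" using \<open>\<xi> \<in> range c\<close> by (simp add: C_def \<alpha> comp_def)
      ultimately show ?thesis by (simp add: \<theta>_def \<alpha>)
    qed
    then show "\<exists>\<alpha>. \<forall>\<xi>\<in>S. \<theta> \<alpha> \<xi> = r \<xi>" by blast
  next
    fix J :: "nat set set" and \<alpha> k
    assume J: "finite J" "\<alpha> \<in> J" "k \<alpha> \<noteq> (0::int)"
    show "countable {x. (\<Sum>\<alpha>\<in>J. of_int (k \<alpha>) * pairing (\<theta> \<alpha>) x) \<in> \<int>}"
    proof (rule countable_kernel_of_independent_tail[where \<beta> = "branch_real \<circ> pair" and C = C])
      fix J :: "(nat set \<times> nat set) set" and k :: "_ \<Rightarrow> int" and i
      assume *: "finite J" "(\<Sum>i\<in>J. of_int (k i) * (branch_real \<circ> pair) i) \<in> \<int>" "i \<in> J"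
      have "(\<Sum>A\<in>pair ` J. of_int (k (inv_into UNIV pair A)) * branch_real A) \<in> \<int>"
        using *(2) \<open>inj pair\<close> inj_on_subset[OF \<open>inj pair\<close> subset_UNIV] by (simp add: sum.reindex)
      from branch_real_independent[OF _ this, of "pair i"] show "k i = 0"
        using * \<open>inj pair\<close> by simp
    next
      show "\<theta> \<alpha> \<xi> = (branch_real \<circ> pair) (\<alpha>, \<xi>)" if "\<xi> \<notin> C \<alpha>" for \<alpha> \<xi>
        using that by (simp add: \<theta>_def)
      show "countable (C \<alpha>)" for \<alpha> by (simp add: C_def)
    qed (fact J)+
  qed
  then show ?thesis by blast
qed

subsection \<open>Extending characters\<close>

text \<open>The graph of a character of a subgroup.\<close>
definition partial_character :: "(('a \<Rightarrow>\<^sub>0 int) \<times> complex) set \<Rightarrow> bool" where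
  "partial_character R \<longleftrightarrow> (0, 1) \<in> R \<and> (\<forall>x u. (x, u) \<in> R \<longrightarrow> norm u = 1) \<and>
     (\<forall>x u y v. (x, u) \<in> R \<longrightarrow> (y, v) \<in> R \<longrightarrow> (x - y, u / v) \<in> R) \<and>
     (\<forall>u. (0, u) \<in> R \<longrightarrow> u = 1)"

lemma
  assumes "partial_character R"
  shows partial_character_zero: "(0, 1) \<in> R"
    and partial_character_norm: "(x, u) \<in> R \<Longrightarrow> norm u = 1"
    and partial_character_diff: "\<lbrakk>(x, u) \<in> R; (y, v) \<in> R\<rbrakk> \<Longrightarrow> (x - y, u / v) \<in> R"
    and partial_character_zero_unique: "(0, u) \<in> R \<Longrightarrow> u = 1"
  using assms unfolding partial_character_def by blast+

lemma partial_character_graph: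
  assumes "0 \<in> H" "\<And>x y. \<lbrakk>x \<in> H; y \<in> H\<rbrakk> \<Longrightarrow> x - y \<in> H"
    and "\<And>x. x \<in> H \<Longrightarrow> norm (\<phi> x) = 1" "\<phi> 0 = 1"
    and "\<And>x y. \<lbrakk>x \<in> H; y \<in> H\<rbrakk> \<Longrightarrow> \<phi> (x - y) = \<phi> x / \<phi> y"
  shows "partial_character ((\<lambda>x. (x, \<phi> x)) ` H)"
  unfolding partial_character_def using assms by auto

lemma partial_character_nonzero:
  assumes "partial_character R" "(x, u) \<in> R"
  shows "u \<noteq> 0"
  using partial_character_norm[OF assms] by auto

lemma partial_character_unique:
  assumes "partial_character R" "(x, u) \<in> R" "(x, v) \<in> R"
  shows "u = v"
  using partial_character_zero_unique[OF assms(1), of "u / v"] partial_character_nonzero[OF assms(1,3)]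
    partial_character_diff[OF assms] by simp

lemma partial_character_add:
  assumes "partial_character R" "(x, u) \<in> R" "(y, v) \<in> R"
  shows "(x + y, u * v) \<in> R"
  using partial_character_diff[OF assms(1,2) partial_character_diff[OF assms(1)
        partial_character_zero[OF assms(1)] assms(3)]]
  by simp

lemma partial_character_cmul:
  assumes R: "partial_character R" and xu: "(x, u) \<in> R"
  shows "(frag_cmul k x, u powi k) \<in> R"
proof (induction k rule: int_induct[of _ 0])
  case base
  then show ?case using partial_character_zero[OF R] by simp
next
  case (step1 i)
  then show ?case using partial_character_add[OF R step1(2) xu] partial_character_nonzero[OF R xu]
    by (simp add: frag_cmul_distrib power_int_add)
next
  case (step2 i)
  then show ?case using partial_character_diff[OF R step2(2) xu] partial_character_nonzero[OF R xu]
    by (simp add: frag_cmul_diff_distrib power_int_diff)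
qed

text \<open>An argument \<open>t\<close> of \<open>w\<close> taken above 0 and up to
  \<open>2 * pi\<close>, instead of from 0, puts \<open>t / n\<close> above 0 and up to
  \<open>pi\<close>, where \<open>cis\<close> avoids 1. The root has to differ from 1 to separate
  points from subgroups later.\<close>

lemma ex_nontrivial_root_on_circle:
  fixes w :: complex
  assumes "norm w = 1" "2 \<le> n"
  shows "\<exists>z. norm z = 1 \<and> z \<noteq> 1 \<and> z ^ n = w"
proof -
  have "w = cis (Arg2pi w)" using assms(1) Arg2pi[of w] by (simp add: cis_conv_exp is_Arg_def)
  define t where "t = (if w = 1 then 2 * pi else Arg2pi w)"
  have "0 < t"
  proof (cases "w = 1")
    case False
    with \<open>w = cis (Arg2pi w)\<close> have "Arg2pi w \<noteq> 0" by auto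
    with False show ?thesis using Arg2pi[of w] by (simp add: t_def)
  qed (simp add: t_def)
  moreover have "t \<le> 2 * pi" using Arg2pi[of w] by (simp add: t_def)
  moreover have "cis t = w" using \<open>w = cis (Arg2pi w)\<close> by (simp add: t_def)
  ultimately have t: "0 < t" "t \<le> 2 * pi" "cis t = w" by blast+
  have "t * 2 \<le> 2 * pi * n" using t assms(2) by (intro mult_mono) auto
  then have "0 < t / n" "t / n \<le> pi" using t assms(2) by (auto simp: field_simps)
  then have "cos (t / n) < cos 0" by (intro cos_monotone_0_pi) auto
  then have "cis (t / n) \<noteq> 1" by (auto simp: complex_eq_iff)
  moreover have "cis (t / n) ^ n = w" using t(3) assms(2) by (simp add: Complex.DeMoivre)
  ultimately show ?thesis by (intro exI[of _ "cis (t / n)"]) auto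
qed

text \<open>The integers \<open>k\<close> with \<open>k x\<close> in the domain are the multiples of
  some \<open>n\<close>. If \<open>n = 0\<close> there is no constraint; otherwise
  \<open>n \<ge> 2\<close>, as \<open>x\<close> itself is outside, and \<open>z\<close> can be an
  \<open>n\<close>-th root of the value at \<open>n x\<close>.\<close>

lemma ex_compatible_value:
  fixes R :: "(('a \<Rightarrow>\<^sub>0 int) \<times> complex) set"
  assumes R: "partial_character R" and x: "x \<notin> Domain R"
  shows "\<exists>z. norm z = 1 \<and> z \<noteq> 1 \<and> (\<forall>k w. (frag_cmul k x, w) \<in> R \<longrightarrow> w = z powi k)"
proof (cases "\<exists>n>0. frag_cmul (int n) x \<in> Domain R")
  case False
  have "k = 0" if k: "(frag_cmul k x, w) \<in> R" for k w
  proof (rule ccontr)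
    assume "k \<noteq> 0"
    moreover have "(frag_cmul (- k) x, w powi - 1) \<in> R"
      using partial_character_cmul[OF R k, of "- 1"] by simp
    ultimately show False
      using False k by (metis DomainI neg_0_less_iff_less linorder_neqE_linordered_idom zero_less_imp_eq_int)
  qed
  \<comment> \<open>Only the multiple 0 is constrained, where the value is 1 anyway; -1 is one value
    on the circle other than 1.\<close>
  then show ?thesis
    using partial_character_zero_unique[OF R] by (intro exI[of _ "- 1"]) fastforce
next
  case True
  define n where "n = (LEAST n. n > 0 \<and> frag_cmul (int n) x \<in> Domain R)"
  have n: "n > 0" "frag_cmul (int n) x \<in> Domain R"
    using LeastI_ex[OF True] unfolding n_def by auto
  have least: "frag_cmul (int m) x \<notin> Domain R" if "0 < m" "m < n" for m
    using not_less_Least[of m] that unfolding n_def by blast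
  obtain w0 where w0: "(frag_cmul (int n) x, w0) \<in> R" using n(2) by blast
  have "n \<noteq> 1" using n(2) x by auto
  then obtain z where z: "norm z = 1" "z \<noteq> 1" "z ^ n = w0"
    using ex_nontrivial_root_on_circle[OF partial_character_norm[OF R w0], of n] n(1) by auto
  have "w = z powi k" if k: "(frag_cmul k x, w) \<in> R" for k w
  proof -
    have q: "(frag_cmul (k div n * n) x, w0 powi (k div n)) \<in> R"
      using partial_character_cmul[OF R w0, of "k div n"] by simp
    have "(frag_cmul (k mod n) x, w / w0 powi (k div n)) \<in> R"
      using partial_character_diff[OF R k q]
      by (simp add: minus_div_mult_eq_mod flip: frag_cmul_diff_distrib)
    \<comment> \<open>A nonzero remainder would be a smaller positive multiple in the
      domain.\<close>
    then have "k mod n = 0"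
      using least[of "nat (k mod n)"] n(1)
      by (metis DomainI Euclidean_Rings.pos_mod_bound Euclidean_Rings.pos_mod_sign nat_0_le
          of_nat_0_less_iff of_nat_less_imp_less order_le_less zero_less_nat_eq)
    then have kq: "k = n * (k div n)" by auto
    then have "w = w0 powi (k div n)"
      using partial_character_unique[OF R k] q by (simp add: mult.commute)
    also have "\<dots> = z powi (n * (k div n))"
      by (simp add: power_int_mult flip: z(3))
    finally show ?thesis using kq by simp
  qed
  then show ?thesis using z by blast
qed

text \<open>The elements \<open>y + k x\<close> receive the values \<open>u z^k\<close>.
  Compatibility of \<open>z\<close> makes the value at 0 unique, which together with closure under
  differences is single-valuedness.\<close>

lemma partial_character_adjoin:
  assumes R: "partial_character R" and x: "x \<notin> Domain R"
  shows "\<exists>R' z. partial_character R' \<and> R \<subseteq> R' \<and> (x, z) \<in> R' \<and> z \<noteq> 1"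
proof -
  obtain z where z: "norm z = 1" "z \<noteq> 1" and zk: "\<And>k w. (frag_cmul k x, w) \<in> R \<Longrightarrow> w = z powi k"
    using ex_compatible_value[OF assms] by blast
  then have z0: "z \<noteq> 0" by auto
  define R' where "R' = {(y + frag_cmul k x, u * z powi k) | y u k. (y, u) \<in> R}"
  have "partial_character R'"
    unfolding partial_character_def
  proof (intro conjI allI impI)
    show "(0, 1) \<in> R'" using partial_character_zero[OF R] unfolding R'_def
      by (intro CollectI exI[of _ 0] exI[of _ 1] exI[of _ "0::int"]) auto
    show "norm u = 1" if "(y, u) \<in> R'" for y u
      using that partial_character_norm[OF R] z(1) by (auto simp: R'_def norm_mult norm_power_int)
    show "(a - b, u / v) \<in> R'" if ab: "(a, u) \<in> R'" "(b, v) \<in> R'" for a u b v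
    proof -
      obtain a' u' k where a: "a = a' + frag_cmul k x" "u = u' * z powi k" "(a', u') \<in> R"
        using ab(1) by (auto simp: R'_def)
      obtain b' v' l where b: "b = b' + frag_cmul l x" "v = v' * z powi l" "(b', v') \<in> R"
        using ab(2) by (auto simp: R'_def)
      have "a - b = (a' - b') + frag_cmul (k - l) x" "u / v = u' / v' * z powi (k - l)"
        using a b z0 by (auto simp: frag_cmul_diff_distrib power_int_diff)
      then show ?thesis using partial_character_diff[OF R a(3) b(3)] unfolding R'_def by blast
    qed
    show "u = 1" if uR: "(0, u) \<in> R'" for u
    proof -
      obtain y u' k where y: "0 = y + frag_cmul k x" "u = u' * z powi k" "(y, u') \<in> R"
        using uR unfolding R'_def by blast
      have "y = frag_cmul (- k) x" using y(1) by (metis minus_frag_cmul neg_eq_iff_add_eq_0 minus_minus add.commute)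
      then have "u' = z powi - k" using zk y(3) by auto
      then show ?thesis using y(2) z0 by (simp add: power_int_minus)
    qed
  qed
  moreover have "(y, u) \<in> R'" if "(y, u) \<in> R" for y u
    using that unfolding R'_def by (intro CollectI exI[of _ y] exI[of _ u] exI[of _ "0::int"]) auto
  then have "R \<subseteq> R'" by (intro subrelI)
  moreover have "(x, z) \<in> R'"
    using partial_character_zero[OF R] unfolding R'_def
    by (intro CollectI exI[of _ 0] exI[of _ 1] exI[of _ "1::int"]) auto
  ultimately show ?thesis using z(2) by blast
qed

lemma partial_character_Union_chain:
  assumes chain: "\<And>R S. \<lbrakk>R \<in> \<C>; S \<in> \<C>\<rbrakk> \<Longrightarrow> R \<subseteq> S \<or> S \<subseteq> R" and ne: "\<C> \<noteq> {}"
    and pc: "\<And>R. R \<in> \<C> \<Longrightarrow> partial_character R"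
  shows "partial_character (\<Union>\<C>)"
  unfolding partial_character_def
proof (intro conjI allI impI)
  show "(0, 1) \<in> \<Union>\<C>" using ne partial_character_zero[OF pc] by blast
  show "norm u = 1" if "(x, u) \<in> \<Union>\<C>" for x u
    using that by (auto intro: partial_character_norm[OF pc])
  show "u = 1" if "(0, u) \<in> \<Union>\<C>" for u
    using that by (auto intro: partial_character_zero_unique[OF pc])
  show "(x - y, u / v) \<in> \<Union>\<C>" if xy: "(x, u) \<in> \<Union>\<C>" "(y, v) \<in> \<Union>\<C>" for x u y v
  proof -
    obtain R S where RS: "(x, u) \<in> R" "(y, v) \<in> S" "R \<in> \<C>" "S \<in> \<C>" using xy by blast
    then obtain Q where "Q \<in> \<C>" "(x, u) \<in> Q" "(y, v) \<in> Q" using chain[of R S] by blast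
    then show ?thesis using partial_character_diff[OF pc] by (intro UnionI)
  qed
qed

text \<open>Zorn's lemma: a maximal extension that missed some \<open>x\<close> could be enlarged by
  \<open>partial_character_adjoin\<close>.\<close>

lemma ex_total_extension:
  fixes R :: "(('a \<Rightarrow>\<^sub>0 int) \<times> complex) set"
  assumes R: "partial_character R"
  shows "\<exists>T. partial_character T \<and> R \<subseteq> T \<and> Domain T = UNIV"
proof -
  let ?E = "{T. partial_character T \<and> R \<subseteq> T}"
  have "\<exists>T\<in>?E. \<forall>T'\<in>?E. T \<subseteq> T' \<longrightarrow> T' = T"
  proof (rule subset_Zorn_nonempty)
    show "?E \<noteq> {}" using R by blast
    fix \<C> assume ne: "\<C> \<noteq> {}" and chain: "subset.chain ?E \<C>"
    then have "R' \<subseteq> S \<or> S \<subseteq> R'" if "R' \<in> \<C>" "S \<in> \<C>" for R' S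
      using that unfolding subset_chain_def by blast
    moreover have E: "partial_character S" "R \<subseteq> S" if "S \<in> \<C>" for S
      using chain that unfolding subset_chain_def by blast+
    ultimately have "partial_character (\<Union>\<C>)"
      by (intro partial_character_Union_chain ne)
    then show "\<Union>\<C> \<in> ?E" using E(2) ne by blast
  qed
  then obtain T where "T \<in> ?E" and max: "\<forall>T'\<in>?E. T \<subseteq> T' \<longrightarrow> T' = T" ..
  then have T: "partial_character T" "R \<subseteq> T" by simp_all
  have "x \<in> Domain T" for x
  proof (rule ccontr)
    assume x: "x \<notin> Domain T"
    then obtain T' z where "partial_character T'" "T \<subseteq> T'" "(x, z) \<in> T'"
      using partial_character_adjoin[OF T(1)] by blast
    moreover from this have "T' = T" using max T(2) by simp
    ultimately show False using x by blast
  qed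
  then show ?thesis using T by blast
qed

text \<open>A character of the whole free group is determined by its values on the generators;
  \<open>r\<close> lists their arguments, measured in full turns.\<close>

lemma partial_character_eq_cis_pairing:
  fixes R :: "(('a \<Rightarrow>\<^sub>0 int) \<times> complex) set"
  assumes R: "partial_character R"
  shows "\<exists>r. \<forall>(x, u)\<in>R. u = cis (2 * pi * pairing r x)"
proof -
  obtain T where T: "partial_character T" "R \<subseteq> T" "Domain T = UNIV"
    using ex_total_extension[OF R] by blast
  have "\<exists>t. (frag_of \<xi>, cis (2 * pi * t)) \<in> T" for \<xi>
  proof -
    obtain u where u: "(frag_of \<xi>, u) \<in> T" using T(3) by blast
    then have "cis (2 * pi * (Arg u / (2 * pi))) = u"
      using partial_character_norm[OF T(1) u] cis_Arg[OF partial_character_nonzero[OF T(1) u]]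
      by (simp add: sgn_eq)
    then show ?thesis using u by (intro exI[of _ "Arg u / (2 * pi)"]) simp
  qed
  then obtain r where r: "\<And>\<xi>. (frag_of \<xi>, cis (2 * pi * r \<xi>)) \<in> T" by metis
  have "(x, cis (2 * pi * pairing r x)) \<in> T" for x
    using subset_UNIV[of "Poly_Mapping.keys x"]
  proof (induction x rule: frag_induction)
    case zero
    then show ?case using partial_character_zero[OF T(1)] by simp
  next
    case (diff a b)
    then show ?case using partial_character_diff[OF T(1) diff]
      by (simp add: pairing_diff right_diff_distrib flip: cis_divide)
  qed (use r in auto)
  then have "u = cis (2 * pi * pairing r x)" if "(x, u) \<in> R" for x u
    using partial_character_unique[OF T(1)] T(2) that by (meson subsetD)
  then show ?thesis by blast
qed

subsection \<open>Density in the torus\<close>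

text \<open>Reduction to \<open>Kronecker_thm_2\<close>, which expects a numbered family ending in 1
  that is linearly independent over the integers.\<close>

lemma Kronecker_simultaneous:
  fixes t a :: "'i \<Rightarrow> real"
  assumes J: "finite J" and "\<epsilon> > 0"
    and indep: "\<And>k j. \<lbrakk>(\<Sum>j\<in>J. of_int (k j) * t j) \<in> \<int>; j \<in> J\<rbrakk> \<Longrightarrow> k j = (0::int)"
  shows "\<exists>(k::int) m. \<forall>j\<in>J. \<bar>of_int k * t j - of_int (m j) - a j\<bar> < \<epsilon>"
proof -
  define n where "n = card J"
  obtain f where f: "bij_betw f {..<n} J"
    using ex_bij_betw_nat_finite[OF J] by (auto simp: n_def atLeast0LessThan)
  define g where "g = the_inv_into {..<n} f"
  have g: "g (f i) = i" if "i < n" for i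
    using f that unfolding g_def bij_betw_def by (auto intro: the_inv_into_f_f)
  have g': "g j < n" "f (g j) = j" if "j \<in> J" for j
    using bij_betw_the_inv_into[OF f] f_the_inv_into_f_bij_betw[OF f] that
    unfolding g_def bij_betw_def by auto
  \<comment> \<open>The final entry 1 turns an integer-valued combination of the \<open>t j\<close>
    into a linear relation.\<close>
  define \<theta> where "\<theta> i = (if i < n then t (f i) else 1)" for i
  have coeff: "c i = 0" if c: "(\<Sum>i\<le>n. of_int (c i) * \<theta> i) = 0" and "i \<le> n" for c :: "nat \<Rightarrow> int" and i
  proof -
    have s: "(\<Sum>i\<le>n. of_int (c i) * \<theta> i) = (\<Sum>i<n. of_int (c i) * \<theta> i) + of_int (c n)"
      by (simp add: \<theta>_def flip: lessThan_Suc_atMost)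
    have "(\<Sum>i<n. of_int (c i) * \<theta> i) = (\<Sum>i<n. of_int (c (g (f i))) * t (f i))"
      by (intro sum.cong) (auto simp: \<theta>_def g)
    also have "\<dots> = (\<Sum>j\<in>J. of_int (c (g j)) * t j)"
      by (rule sum.reindex_bij_betw[OF f])
    finally have s': "(\<Sum>i<n. of_int (c i) * \<theta> i) = (\<Sum>j\<in>J. of_int (c (g j)) * t j)" .
    then have "(\<Sum>j\<in>J. of_int (c (g j)) * t j) = of_int (- c n)" using c s by simp
    then have "(\<Sum>j\<in>J. of_int (c (g j)) * t j) \<in> \<int>" by (metis Ints_of_int)
    then have *: "c (g j) = 0" if "j \<in> J" for j using indep[of "\<lambda>j. c (g j)"] that by blast
    have less: "c i = 0" if "i < n" for i
      using *[of "f i"] g[OF that] f that by (auto simp: bij_betw_def)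
    then have "c n = 0" using c s by simp
    with less \<open>i \<le> n\<close> show ?thesis by (cases "i = n") auto
  qed
  \<comment> \<open>Independence of the set of values does not rule out repetitions. Equal entries
    would satisfy the relation with coefficients 1 and -1.\<close>
  have inj: "inj_on \<theta> {..n}"
  proof (rule inj_onI, rule ccontr)
    fix i j assume ij: "i \<in> {..n}" "j \<in> {..n}" "\<theta> i = \<theta> j" "i \<noteq> j"
    have single: "(\<Sum>l\<le>n. of_bool (l = i) * \<theta> l) = \<theta> i" if "i \<le> n" for i
    proof -
      have "(\<Sum>l\<le>n. of_bool (l = i) * \<theta> l) = (\<Sum>l\<le>n. if l = i then \<theta> l else 0)"
        by (rule sum.cong) auto
      then show ?thesis using that by simp
    qed
    have "(\<Sum>l\<le>n. of_int (of_bool (l = i) - of_bool (l = j)) * \<theta> l) = \<theta> i - \<theta> j"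
      using ij single[of i] single[of j] by (simp only: of_int_diff of_int_of_bool left_diff_distrib sum_subtractf atMost_iff)
    then have "of_bool (i = i) - of_bool (i = j) = (0::int)"
      using ij by (intro coeff) auto
    with ij show False by simp
  qed
  interpret M: Modules.module "\<lambda>r x. of_int r * (x::real)"
    by (simp add: Modules.module.intro distrib_left mult.commute)
  have "M.independent (\<theta> ` {..n})"
    unfolding M.independent_explicit_module
  proof (intro allI impI)
    fix V :: "real set" and u v
    assume V: "finite V" "V \<subseteq> \<theta> ` {..n}" and s: "(\<Sum>v\<in>V. of_int (u v) * v) = 0" and v: "v \<in> V"
    obtain i where i: "i \<le> n" "v = \<theta> i" using V v by auto
    \<comment> \<open>Coefficients on \<open>V\<close> are extended by 0 to all entries, so that
      \<open>coeff\<close> applies.\<close>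
    have "(\<Sum>i\<le>n. of_int (if \<theta> i \<in> V then u (\<theta> i) else 0) * \<theta> i)
        = (\<Sum>v\<in>\<theta> ` {..n}. of_int (if v \<in> V then u v else 0) * v)"
      by (simp add: sum.reindex[OF inj])
    also have "\<dots> = (\<Sum>v\<in>V. of_int (u v) * v)"
      by (rule sum.mono_neutral_cong_right) (use V in auto)
    finally have "(if \<theta> i \<in> V then u (\<theta> i) else 0) = 0"
      using s i by (intro coeff) auto
    then show "u v = 0" using i v by simp
  qed
  then obtain k m where km: "\<And>i. i < n \<Longrightarrow> \<bar>of_int k * \<theta> i - of_int (m i) - a (f i)\<bar> < \<epsilon>"
    using Kronecker_thm_2[of \<theta> n \<epsilon> "\<lambda>i. a (f i)"] inj \<open>\<epsilon> > 0\<close> by (auto simp: \<theta>_def)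
  have "\<bar>of_int k * t j - of_int (m (g j)) - a j\<bar> < \<epsilon>" if "j \<in> J" for j
    using km[of "g j"] g'[OF that] by (simp add: \<theta>_def)
  then show ?thesis by (intro exI[of _ k] exI[of _ "\<lambda>j. m (g j)"]) blast
qed

lemma dist_cis_le: "dist (cis a) (cis b) \<le> \<bar>a - b\<bar>"
proof -
  have "cis a - cis b = cis b * (cis (a - b) - 1)"
    by (simp add: right_diff_distrib cis_mult)
  then have "dist (cis a) (cis b) = 2 * \<bar>sin ((a - b) / 2)\<bar>"
    using dist_exp_i_1[of "a - b"] by (simp add: dist_norm norm_mult cis_conv_exp)
  then show ?thesis using abs_sin_x_le_abs_x[of "(a - b) / 2"] by simp
qed

section \<open>Density in terms of finitely many coordinates\<close>

lemma carrier_torus_UNIV: "x \<in> carrier (torus UNIV) \<longleftrightarrow> (\<forall>i. norm (x i) = 1)"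
  by (auto simp: torus_def circle_group_def PiE_iff)

lemma mult_torus_UNIV: "x \<otimes>\<^bsub>torus UNIV\<^esub> y = (\<lambda>i. x i * y i)"
  by (simp add: torus_def circle_group_def restrict_def)

lemma one_torus_UNIV: "\<one>\<^bsub>torus UNIV\<^esub> = (\<lambda>i. 1)"
  by (simp add: torus_def circle_group_def restrict_def)

lemma continuous_map_torus_coordinate: "continuous_map (torus_topology UNIV) circle_topology (\<lambda>x. x i)"
  unfolding torus_topology_def by (rule continuous_map_product_projection) simp

text \<open>A basic open set of the product restricts only finitely many coordinates, and around
  \<open>p\<close> each restriction contains a ball of the circle; the least of the radii serves for
  all.\<close>

lemma dense_in_torusI:
  fixes S :: "('i \<Rightarrow> complex) set"
  assumes S: "S \<subseteq> carrier (torus UNIV)"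
    and approx: "\<And>J p \<epsilon>. \<lbrakk>finite J; \<And>i. norm (p i) = 1; \<epsilon> > 0\<rbrakk>
      \<Longrightarrow> \<exists>s\<in>S. \<forall>i\<in>J. dist (s i) (p i) < \<epsilon>"
  shows "dense_in S (torus_topology UNIV)"
  unfolding dense_in_def dense_intersects_open
proof (intro conjI allI impI)
  show "S \<subseteq> topspace (torus_topology UNIV)" using S by (simp add: topspace_torus_topology)
  fix T :: "('i \<Rightarrow> complex) set"
  assume T: "openin (torus_topology UNIV) T \<and> T \<noteq> {}"
  then obtain p where p: "p \<in> T" by blast
  then have pn: "norm (p i) = 1" for i
    using T openin_subset[of "torus_topology UNIV" T] by (auto simp: topspace_torus_topology carrier_torus_UNIV)
  let ?C = "top_of_set (sphere 0 1) :: complex topology"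
  obtain U where fin: "finite {i. U i \<noteq> topspace ?C}" and U: "\<And>i. openin ?C (U i)"
    and pU: "p \<in> Pi\<^sub>E UNIV U" and UT: "Pi\<^sub>E UNIV U \<subseteq> T"
    using bspec[OF T[THEN conjunct1, unfolded torus_topology_def circle_topology_def
          openin_product_topology_alt] p] by auto
  have "\<exists>e>0. \<forall>y. norm y = 1 \<longrightarrow> dist y (p i) < e \<longrightarrow> y \<in> U i" for i
  proof -
    have "p i \<in> U i" using pU by auto
    with U[of i] have "\<exists>e>0. \<forall>y\<in>sphere 0 1. dist y (p i) < e \<longrightarrow> y \<in> U i"
      unfolding openin_euclidean_subtopology_iff by blast
    then show ?thesis by (simp only: Ball_def mem_sphere_0)
  qed
  then obtain e where e: "\<And>i. e i > 0" "\<And>i y. \<lbrakk>norm y = 1; dist y (p i) < e i\<rbrakk> \<Longrightarrow> y \<in> U i"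
    by metis
  let ?J = "{i. U i \<noteq> topspace ?C}"
  \<comment> \<open>The extra element 1 keeps \<open>Min\<close> meaningful when no coordinate is
    restricted.\<close>
  define \<epsilon> where "\<epsilon> = Min (insert 1 (e ` ?J))"
  have "\<epsilon> > 0" using fin e(1) unfolding \<epsilon>_def by (subst Min_gr_iff) auto
  obtain s where s: "s \<in> S" "\<And>i. i \<in> ?J \<Longrightarrow> dist (s i) (p i) < \<epsilon>"
    using approx[OF fin, of p \<epsilon>] pn \<open>\<epsilon> > 0\<close> by blast
  have sn: "norm (s i) = 1" for i using S s(1) by (auto simp: carrier_torus_UNIV)
  have "s i \<in> U i" for i
  proof (cases "i \<in> ?J")
    case True
    then have "\<epsilon> \<le> e i" using fin unfolding \<epsilon>_def by (intro Min_le) auto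
    then show ?thesis using e(2)[OF sn] s(2)[OF True] by simp
  next
    case False
    then have "U i = sphere 0 1" by simp
    then show ?thesis using sn by simp
  qed
  then have "s \<in> T" using UT by auto
  then show "S \<inter> T \<noteq> {}" using s(1) by blast
qed

subsection \<open>The embedded free abelian group\<close>

context generic_angles
begin

text \<open>Evaluation of \<open>x\<close> at the characters with angles
  \<open>\<theta> \<alpha>\<close>, for all \<alpha> at once. The range becomes the group of the
  theorem.\<close>

definition embedding :: "('a \<Rightarrow>\<^sub>0 int) \<Rightarrow> 'i \<Rightarrow> complex" where
  "embedding x = (\<lambda>\<alpha>. cis (2 * pi * pairing (\<theta> \<alpha>) x))"

abbreviation image_group :: "('i \<Rightarrow> complex) monoid" where
  "image_group \<equiv> (torus UNIV)\<lparr>carrier := range embedding\<rparr>"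

abbreviation image_topology :: "('i \<Rightarrow> complex) topology" where
  "image_topology \<equiv> subtopology (torus_topology UNIV) (range embedding)"

lemma embedding_in_torus: "embedding x \<in> carrier (torus UNIV)"
  by (simp add: carrier_torus_UNIV embedding_def)

lemma embedding_zero: "embedding 0 = \<one>\<^bsub>torus UNIV\<^esub>"
  by (simp add: embedding_def one_torus_UNIV)

lemma embedding_add: "embedding (x + y) = embedding x \<otimes>\<^bsub>torus UNIV\<^esub> embedding y"
  by (simp add: embedding_def mult_torus_UNIV pairing_add distrib_left cis_mult)

lemma embedding_uminus: "embedding (- x) = inv\<^bsub>torus UNIV\<^esub> embedding x"
  by (rule group.inv_equality[symmetric, OF group_torus])
    (simp_all add: embedding_in_torus flip: embedding_add embedding_zero)

text \<open>Supports are finite, so countably many elements involve only countably many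
  generators.\<close>

lemma interpolate_pairing:
  assumes "countable H"
  shows "\<exists>\<alpha>. \<forall>x\<in>H. pairing (\<theta> \<alpha>) x = pairing r x"
proof -
  have "countable (\<Union>x\<in>H. Poly_Mapping.keys x)" using assms by (auto simp: countable_finite)
  from interpolation[OF this, of r] obtain \<alpha>
    where "\<And>\<xi>. \<xi> \<in> (\<Union>x\<in>H. Poly_Mapping.keys x) \<Longrightarrow> \<theta> \<alpha> \<xi> = r \<xi>" by blast
  then have "\<forall>x\<in>H. pairing (\<theta> \<alpha>) x = pairing r x" by (auto intro!: pairing_cong)
  then show ?thesis ..
qed

text \<open>Give one generator in the support of \<open>x - y\<close> the angle that makes the
  pairing 1/2, and all others the angle 0. Interpolation yields a coordinate with value -1 at the
  difference.\<close>

lemma inj_embedding: "inj embedding"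
proof (rule injI, rule ccontr)
  fix x y assume eq: "embedding x = embedding y" and "x \<noteq> y"
  define z where "z = x - y"
  have "Poly_Mapping.keys z \<noteq> {}" using \<open>x \<noteq> y\<close> by (simp add: z_def)
  then obtain \<xi> where \<xi>: "\<xi> \<in> Poly_Mapping.keys z" by blast
  define r where "r \<eta> = (if \<eta> = \<xi> then 1 / (2 * of_int (Poly_Mapping.lookup z \<xi>)) else 0 :: real)" for \<eta>
  obtain \<alpha> where \<alpha>: "pairing (\<theta> \<alpha>) z = pairing r z" using interpolate_pairing[of "{z}"] by auto
  have "pairing r z = 1 / 2"
    using \<xi> by (simp add: pairing_def r_def if_distrib sum.delta in_keys_iff cong: if_cong)
  then have "embedding z \<alpha> = -1" unfolding embedding_def \<alpha> by (simp only:) simp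
  moreover have "embedding x \<alpha> = embedding z \<alpha> * embedding y \<alpha>"
    using embedding_add[of z y] by (simp add: z_def mult_torus_UNIV)
  moreover have "embedding y \<alpha> \<noteq> 0" by (simp add: embedding_def)
  ultimately show False using eq by simp
qed

lemma subgroup_range_embedding: "subgroup (range embedding) (torus UNIV)"
proof (rule subgroup.intro)
  show "\<one>\<^bsub>torus UNIV\<^esub> \<in> range embedding" by (metis embedding_zero rangeI)
  show "inv\<^bsub>torus UNIV\<^esub> x \<in> range embedding" if "x \<in> range embedding" for x
    using that by (auto simp flip: embedding_uminus)
qed (auto simp: embedding_in_torus simp flip: embedding_add)

lemma group_image_group: "group image_group"
  by (rule subgroup.subgroup_is_group[OF subgroup_range_embedding group_torus])

lemma topspace_image_topology: "topspace image_topology = range embedding"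
  using embedding_in_torus by (auto simp: topspace_torus_topology)

lemma continuous_map_image_coordinate: "continuous_map image_topology circle_topology (\<lambda>x. x \<alpha>)"
  by (rule continuous_map_from_subtopology[OF continuous_map_torus_coordinate])

lemma subgroup_torus_of_image:
  assumes "subgroup S image_group"
  shows "subgroup S (torus UNIV)"
  by (rule group.incl_subgroup[OF group_torus subgroup_range_embedding assms])

lemma embedding_diff_closed:
  assumes "subgroup S (torus UNIV)" "embedding x \<in> S" "embedding y \<in> S"
  shows "embedding (x - y) \<in> S"
  using subgroup.m_closed[OF assms(1,2) subgroup.m_inv_closed[OF assms(1,3)]]
  by (simp flip: embedding_uminus embedding_add)

lemma embedding_cmul_closed:
  assumes S: "subgroup S (torus UNIV)" and x: "embedding x \<in> S"
  shows "embedding (frag_cmul k x) \<in> S"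
proof (induction k rule: int_induct[of _ 0])
  case base
  then show ?case using subgroup.one_closed[OF S] by (simp add: embedding_zero)
next
  case (step1 i)
  then show ?case using subgroup.m_closed[OF S step1(2) x]
    by (simp add: frag_cmul_distrib embedding_add)
next
  case (step2 i)
  then show ?case using embedding_diff_closed[OF S step2(2) x]
    by (simp add: frag_cmul_diff_distrib)
qed

section \<open>Uncountable subgroups\<close>

lemma uncountable_range_embedding:
  assumes "uncountable (UNIV :: 'a set)"
  shows "uncountable (range embedding)"
proof
  assume "countable (range embedding)"
  then have "countable (range (\<lambda>\<xi>. embedding (frag_of \<xi>)))"
    by (rule countable_subset[rotated]) auto
  moreover have "inj (\<lambda>\<xi>. embedding (frag_of \<xi>))"
    by (intro injI) (auto dest!: injD[OF inj_embedding] simp: frag_of_eq)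
  ultimately show False using assms countable_image_inj_on by blast
qed

lemma countable_vimage_embedding: "countable S \<Longrightarrow> countable (embedding -` S)"
  using countable_image_inj_Int_vimage[OF inj_embedding] by simp

text \<open>There are countably many nonzero coefficient vectors on \<open>J\<close>, each with a
  countable kernel, and the union of these kernels cannot cover \<open>H\<close>.\<close>

lemma ex_independent_element:
  assumes J: "finite J" and H: "uncountable H"
  shows "\<exists>x\<in>H. \<forall>k. (\<Sum>\<alpha>\<in>J. of_int (k \<alpha>) * pairing (\<theta> \<alpha>) x) \<in> \<int> \<longrightarrow> (\<forall>\<alpha>\<in>J. k \<alpha> = (0::int))"
proof -
  let ?Ker = "\<lambda>k. {x. (\<Sum>\<alpha>\<in>J. of_int (k \<alpha> :: int) * pairing (\<theta> \<alpha>) x) \<in> \<int>}"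
  \<comment> \<open>Vectors are extensional on \<open>J\<close> to keep them countable in number; an
    arbitrary \<open>k\<close> is cut down by \<open>restrict\<close>.\<close>
  let ?K = "{k \<in> J \<rightarrow>\<^sub>E (UNIV :: int set). \<exists>\<alpha>\<in>J. k \<alpha> \<noteq> 0}"
  have "countable ?K"
    by (rule countable_subset[OF _ countable_PiE[OF J]]) auto
  moreover have "countable (?Ker k)" if "k \<in> ?K" for k
    using that countable_kernel[OF J] by blast
  ultimately have "countable (\<Union>k\<in>?K. ?Ker k)" by (rule countable_UN)
  then have "\<not> H \<subseteq> (\<Union>k\<in>?K. ?Ker k)" using H countable_subset by blast
  then obtain x where x: "x \<in> H" "\<And>k. k \<in> ?K \<Longrightarrow> x \<notin> ?Ker k" by blast
  have "\<forall>\<alpha>\<in>J. k \<alpha> = 0" if "(\<Sum>\<alpha>\<in>J. of_int (k \<alpha>) * pairing (\<theta> \<alpha>) x) \<in> \<int>" for k :: "'i \<Rightarrow> int"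
  proof -
    have "(\<Sum>\<alpha>\<in>J. of_int (restrict k J \<alpha>) * pairing (\<theta> \<alpha>) x) = (\<Sum>\<alpha>\<in>J. of_int (k \<alpha>) * pairing (\<theta> \<alpha>) x)"
      by (rule sum.cong) auto
    then have "restrict k J \<notin> ?K" using x(2)[of "restrict k J"] that by auto
    then show ?thesis by auto
  qed
  then show ?thesis using x(1) by blast
qed

text \<open>For given \<open>J\<close>, multiples of a single element \<open>x\<close> suffice: if
  its angles at \<open>J\<close> are independent modulo the integers, Kronecker's theorem brings a
  multiple close to any target.\<close>

lemma uncountable_subgroup_dense:
  assumes S: "subgroup S (torus UNIV)" "S \<subseteq> range embedding" and unc: "uncountable S"
  shows "dense_in S (torus_topology UNIV)"
proof (rule dense_in_torusI)
  show "S \<subseteq> carrier (torus UNIV)" using S(1) by (rule subgroup.subset)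
  fix J :: "'i set" and p :: "'i \<Rightarrow> complex" and \<epsilon> :: real
  assume J: "finite J" and p: "\<And>i. norm (p i) = 1" and "\<epsilon> > 0"
  have "S = embedding ` (embedding -` S)" using S(2) by auto
  then have "uncountable (embedding -` S)" using unc countable_image by metis
  from ex_independent_element[OF J this] obtain x where x: "embedding x \<in> S"
    and ind: "\<And>k. (\<Sum>\<alpha>\<in>J. of_int (k \<alpha>) * pairing (\<theta> \<alpha>) x) \<in> \<int> \<Longrightarrow> \<forall>\<alpha>\<in>J. k \<alpha> = (0::int)"
    by auto
  \<comment> \<open>Angles are in full turns, hence the division of the target by
    \<open>2 * pi\<close>. The tolerance shrinks likewise, since \<open>2 * pi\<close> bounds the
    stretching from turns to distance on the circle.\<close>
  have "\<exists>(k::int) m. \<forall>\<alpha>\<in>J. \<bar>of_int k * pairing (\<theta> \<alpha>) x - of_int (m \<alpha>) - Arg (p \<alpha>) / (2 * pi)\<bar>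
      < \<epsilon> / (2 * pi)"
    by (rule Kronecker_simultaneous[OF J]) (use ind \<open>\<epsilon> > 0\<close> in auto)
  then obtain k :: int and m :: "'i \<Rightarrow> int" where km:
    "\<And>\<alpha>. \<alpha> \<in> J \<Longrightarrow> \<bar>of_int k * pairing (\<theta> \<alpha>) x - of_int (m \<alpha>) - Arg (p \<alpha>) / (2 * pi)\<bar> < \<epsilon> / (2 * pi)"
    by blast
  have "dist (embedding (frag_cmul k x) \<alpha>) (p \<alpha>) < \<epsilon>" if "\<alpha> \<in> J" for \<alpha>
  proof -
    let ?u = "of_int k * pairing (\<theta> \<alpha>) x"
    have "p \<alpha> \<noteq> 0" using p[of \<alpha>] by auto
    then have pa: "p \<alpha> = cis (Arg (p \<alpha>))" using cis_Arg[of "p \<alpha>"] p[of \<alpha>] by (simp add: sgn_eq)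
    have "embedding (frag_cmul k x) \<alpha> = cis (2 * pi * ?u)"
      by (simp add: embedding_def pairing_frag_cmul)
    also have "\<dots> = cis (2 * pi * ?u - 2 * pi * of_int (m \<alpha>))"
      by (simp add: flip: cis_divide)
    finally have "dist (embedding (frag_cmul k x) \<alpha>) (p \<alpha>)
        \<le> \<bar>2 * pi * ?u - 2 * pi * of_int (m \<alpha>) - Arg (p \<alpha>)\<bar>"
      using dist_cis_le pa by metis
    also have "\<dots> = 2 * pi * \<bar>?u - of_int (m \<alpha>) - Arg (p \<alpha>) / (2 * pi)\<bar>"
    proof -
      have "2 * pi * ?u - 2 * pi * of_int (m \<alpha>) - Arg (p \<alpha>)
          = 2 * pi * (?u - of_int (m \<alpha>) - Arg (p \<alpha>) / (2 * pi))"
        by (simp add: right_diff_distrib)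
      then show ?thesis by (simp only: abs_mult) simp
    qed
    also have "\<dots> < 2 * pi * (\<epsilon> / (2 * pi))" using km[OF that] by (intro mult_strict_left_mono) auto
    finally show ?thesis by simp
  qed
  then show "\<exists>s\<in>S. \<forall>\<alpha>\<in>J. dist (s \<alpha>) (p \<alpha>) < \<epsilon>"
    using embedding_cmul_closed[OF S(1) x] by blast
qed

section \<open>Countable subgroups\<close>

text \<open>Pulled back along \<open>embedding\<close>, \<open>f\<close> is given by angles
  \<open>r\<close>, and interpolation finds a coordinate with the same pairings on the countable
  preimage of \<open>S\<close>. The extension is the projection to this coordinate, hence
  continuous.\<close>

lemma countable_subgroup_h_embedded:
  assumes S: "subgroup S image_group" and "countable S"
  shows "h_embedded S image_group image_topology"
  unfolding h_embedded_def
proof (intro conjI S ballI)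
  fix f assume f: "f \<in> hom (image_group\<lparr>carrier := S\<rparr>) circle_group"
  note S' = subgroup_torus_of_image[OF S]
  have f_mult: "f (embedding (x + y)) = f (embedding x) * f (embedding y)"
    if "embedding x \<in> S" "embedding y \<in> S" for x y
    using f that by (simp add: hom_def embedding_add circle_group_def)
  have f_norm: "norm (f (embedding x)) = 1" if "embedding x \<in> S" for x
    using f that by (auto simp: hom_def circle_group_def)
  have f_nz: "f (embedding x) \<noteq> 0" if "embedding x \<in> S" for x
    using f_norm[OF that] by auto
  have zero: "embedding 0 \<in> S" using subgroup.one_closed[OF S'] by (simp add: embedding_zero)
  have f0: "f (embedding 0) = 1" using f_mult[OF zero zero] f_nz[OF zero] by simp
  have f_diff: "f (embedding (x - y)) = f (embedding x) / f (embedding y)"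
    if "embedding x \<in> S" "embedding y \<in> S" for x y
    using f_mult[OF embedding_diff_closed[OF S' that] that(2)] f_nz[OF that(2)] by simp
  have "partial_character ((\<lambda>x. (x, f (embedding x))) ` (embedding -` S))"
    using zero embedding_diff_closed[OF S'] f_norm f0 f_diff
    by (intro partial_character_graph) simp_all
  from partial_character_eq_cis_pairing[OF this] obtain r
    where r: "\<And>x. embedding x \<in> S \<Longrightarrow> f (embedding x) = cis (2 * pi * pairing r x)" by auto
  obtain \<alpha> where \<alpha>: "\<And>x. embedding x \<in> S \<Longrightarrow> pairing (\<theta> \<alpha>) x = pairing r x"
    using interpolate_pairing[OF countable_vimage_embedding[OF \<open>countable S\<close>], of r] by auto
  have "(\<lambda>y. y \<alpha>) \<in> hom image_group circle_group"
    using embedding_in_torus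
    by (auto simp: hom_def circle_group_def mult_torus_UNIV carrier_torus_UNIV)
  moreover have "y \<alpha> = f y" if "y \<in> S" for y
  proof -
    obtain x where "y = embedding x" using subgroup.subset[OF S] \<open>y \<in> S\<close> by auto
    then show ?thesis using r[of x] \<alpha>[of x] that by (simp add: embedding_def)
  qed
  ultimately show "\<exists>g\<in>hom image_group circle_group.
      continuous_map image_topology circle_topology g \<and> (\<forall>x\<in>S. g x = f x)"
    using continuous_map_image_coordinate by blast
qed

text \<open>Extend the trivial character of \<open>S\<close> with a value other than 1 at
  \<open>y\<close>, and realise the extension on the countable set of \<open>y\<close> and
  \<open>S\<close> by a coordinate.\<close>

lemma separating_coordinate:
  assumes S: "subgroup S (torus UNIV)" "countable S" and y: "y \<in> range embedding" "y \<notin> S"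
  shows "\<exists>\<alpha>. y \<alpha> \<noteq> 1 \<and> (\<forall>s \<in> S \<inter> range embedding. s \<alpha> = 1)"
proof -
  obtain x where x: "y = embedding x" using y(1) by blast
  let ?R = "(\<lambda>x. (x, 1)) ` (embedding -` S)"
  have "partial_character ?R"
  proof (rule partial_character_graph)
    show "0 \<in> embedding -` S" using subgroup.one_closed[OF S(1)] by (simp add: embedding_zero)
    show "x - y \<in> embedding -` S" if "x \<in> embedding -` S" "y \<in> embedding -` S" for x y
      using embedding_diff_closed[OF S(1)] that by simp
  qed simp_all
  moreover have "x \<notin> Domain ?R" using x y(2) by auto
  ultimately have "\<exists>R z. partial_character R \<and> ?R \<subseteq> R \<and> (x, z) \<in> R \<and> z \<noteq> 1"
    by (rule partial_character_adjoin)
  then obtain R z where R: "partial_character R" "?R \<subseteq> R" "(x, z) \<in> R" "z \<noteq> 1" by blast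
  from partial_character_eq_cis_pairing[OF R(1)]
  obtain r where "\<forall>(x, u)\<in>R. u = cis (2 * pi * pairing r x)" ..
  then have r: "u = cis (2 * pi * pairing r x)" if "(x, u) \<in> R" for x u using that by blast
  have "countable (insert x (embedding -` S))"
    using countable_vimage_embedding[OF S(2)] by simp
  from interpolate_pairing[OF this, of r] obtain \<alpha>
    where \<alpha>: "pairing (\<theta> \<alpha>) x = pairing r x" "\<And>w. embedding w \<in> S \<Longrightarrow> pairing (\<theta> \<alpha>) w = pairing r w"
    by auto
  have "y \<alpha> = z" using r[OF R(3)] \<alpha>(1) x by (simp add: embedding_def)
  moreover have "embedding w \<alpha> = 1" if "embedding w \<in> S" for w
  proof -
    have "(w, 1) \<in> R" using R(2) that by auto
    then show ?thesis using r[of w 1] \<alpha>(2)[OF that] by (simp add: embedding_def)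
  qed
  ultimately show ?thesis using R(4) by (intro exI[of _ \<alpha>]) auto
qed

text \<open>The separating coordinate differs from 1 on an open neighbourhood of \<open>y\<close>,
  which therefore misses \<open>S\<close>.\<close>

lemma countable_subgroup_closed:
  assumes S: "subgroup S image_group" and "countable S"
  shows "closedin image_topology S"
  unfolding closedin_def
proof (intro conjI)
  have sub: "S \<subseteq> range embedding" using subgroup.subset[OF S] by simp
  then show "S \<subseteq> topspace image_topology" by (simp only: topspace_image_topology)
  show "openin image_topology (topspace image_topology - S)"
  proof (subst openin_subopen, intro ballI)
    fix y assume "y \<in> topspace image_topology - S"
    then have y: "y \<in> range embedding" "y \<notin> S" unfolding topspace_image_topology by auto
    obtain \<alpha> where \<alpha>: "y \<alpha> \<noteq> 1" "\<And>s. s \<in> S \<Longrightarrow> s \<alpha> = 1"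
      using separating_coordinate[OF subgroup_torus_of_image[OF S] \<open>countable S\<close> y] sub by blast
    have "continuous_map image_topology euclidean (\<lambda>x. x \<alpha>)"
      using continuous_map_image_coordinate[of \<alpha>]
      by (simp add: circle_topology_def continuous_map_in_subtopology)
    then have "openin image_topology {x \<in> topspace image_topology. x \<alpha> \<in> - {1}}"
      by (rule openin_continuous_map_preimage) (simp add: open_Compl)
    moreover have "y \<in> {x \<in> topspace image_topology. x \<alpha> \<in> - {1}}"
      unfolding topspace_image_topology using y \<alpha>(1) by simp
    moreover have "{x \<in> topspace image_topology. x \<alpha> \<in> - {1}} \<subseteq> topspace image_topology - S"
      using \<alpha>(2) by auto
    ultimately show "\<exists>T. openin image_topology T \<and> y \<in> T \<and> T \<subseteq> topspace image_topology - S"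
      by blast
  qed
qed

lemma uncountable_subgroup_dense_in_image:
  assumes S: "subgroup S image_group" and "uncountable S"
  shows "dense_in S image_topology"
proof -
  have sub: "S \<subseteq> range embedding" using subgroup.subset[OF S] by simp
  then have "torus_topology UNIV closure_of S = topspace (torus_topology UNIV)"
    using uncountable_subgroup_dense[OF subgroup_torus_of_image[OF S]] \<open>uncountable S\<close>
    by (simp add: dense_in_def)
  with sub show ?thesis
    by (simp add: dense_in_def closure_of_subtopology topspace_image_topology[simplified] Int_absorb1)
      (auto simp: topspace_torus_topology embedding_in_torus)
qed

end

subsection \<open>Quotients\<close>

text \<open>The stages \<open>L n\<close> start from \<open>H\<close>, its inverses and the unit,
  and each adds the products of two earlier elements. They are countable and exhaust the generated
  set; as they increase, two elements always share a stage.\<close>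

lemma countable_generate:
  assumes "countable H"
  shows "countable (generate G H)"
proof -
  let ?step = "\<lambda>B. B \<union> (\<lambda>(a, b). a \<otimes>\<^bsub>G\<^esub> b) ` (B \<times> B)"
  define L where "L n = (?step ^^ n) (insert \<one>\<^bsub>G\<^esub> (H \<union> (\<lambda>h. inv\<^bsub>G\<^esub> h) ` H))" for n
  have Suc: "L (Suc n) = ?step (L n)" for n by (simp add: L_def)
  have "countable (L n)" for n
    using assms by (induction n) (auto simp: Suc, simp add: L_def)
  then have "countable (\<Union>n. L n)" by simp
  moreover have "x \<in> (\<Union>n. L n)" if "x \<in> generate G H" for x
    using that
  proof induction
    case (eng a b)
    then obtain m n where "a \<in> L m" "b \<in> L n" by blast
    moreover have mono: "L m \<subseteq> L n" if "m \<le> n" for m n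
      using that by (rule lift_Suc_mono_le[rotated]) (simp add: Suc)
    moreover have "L m \<subseteq> L (max m n)" "L n \<subseteq> L (max m n)" by (intro mono; simp)+
    ultimately have "a \<in> L (max m n)" "b \<in> L (max m n)" by blast+
    then have "a \<otimes>\<^bsub>G\<^esub> b \<in> L (Suc (max m n))" by (auto simp: Suc)
    then show ?case by blast
  qed (auto intro!: exI[of _ 0] simp: L_def)
  ultimately show ?thesis by (meson countable_subset subsetI)
qed

lemma topspace_quotient_group_topology:
  assumes "topspace X = carrier G"
  shows "topspace (quotient_group_topology G X N) = carrier (G Mod N)"
  using quotient_map_quotient_group_topology[OF assms, of N] assms
  by (auto simp: quotient_map_def carrier_FactGroup)

text \<open>A countable dense set of cosets generates, together with \<open>N\<close>, a countable subgroup;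
  being closed and saturated it has closed dense image in the quotient, so it is everything.\<close>
lemma not_separable_quotient_by_countable:
  fixes G (structure)
  assumes top: "topspace X = carrier G" and unc: "uncountable (carrier G)"
    and closed: "\<And>S. \<lbrakk>subgroup S G; countable S\<rbrakk> \<Longrightarrow> closedin X S"
    and N: "N \<lhd> G" "countable N"
  shows "\<not> separable_space (quotient_group_topology G X N)"
proof
  let ?Q = "quotient_group_topology G X N"
  interpret normal N G by (rule N(1))
  assume "separable_space ?Q"
  then obtain D where D: "countable D" "D \<subseteq> carrier (G Mod N)"
    and dense: "?Q closure_of D = topspace ?Q"
    unfolding separable_space_def topspace_quotient_group_topology[OF top] by auto
  define S where "S = generate G (N \<union> \<Union>D)"
  have coset: "\<exists>x\<in>carrier G. d = N #> x" if "d \<in> D" for d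
    using that D(2) unfolding carrier_FactGroup by blast
  have sub: "N \<union> \<Union>D \<subseteq> carrier G"
  proof -
    have "d \<subseteq> carrier G" if "d \<in> D" for d
      using coset[OF that] r_coset_subset_G[OF subset] by blast
    then show ?thesis using subset by blast
  qed
  \<comment> \<open>A coset is a translate of the countable \<open>N\<close>, so the union of
    \<open>D\<close> is countable.\<close>
  have "countable d" if d: "d \<in> D" for d
  proof -
    obtain x where "d = N #> x" using coset[OF d] by blast
    then have "d = (\<lambda>h. h \<otimes> x) ` N" by (auto simp: r_coset_def)
    then show ?thesis using N(2) by simp
  qed
  then have "countable (\<Union>D)" using countable_UN[of D "\<lambda>d. d"] D(1) by simp
  then have cS: "countable S" unfolding S_def using N(2) by (intro countable_generate) simp
  have S: "subgroup S G" unfolding S_def by (rule generate_is_subgroup[OF sub])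
  have incl: "N \<union> \<Union>D \<subseteq> S" unfolding S_def by (auto intro: generate.incl)
  \<comment> \<open>As \<open>N\<close> lies in \<open>S\<close>, \<open>S\<close> is a union of
    cosets, and its complement is the full preimage of \<open>?U\<close> below.\<close>
  have saturated: "x \<in> S" if "x \<in> carrier G" "N #> x = N #> s" "s \<in> S" for x s
  proof -
    have "x \<in> N #> s" using rcos_self[OF that(1) is_subgroup] that(2) by simp
    then obtain h where "h \<in> N" "x = h \<otimes> s" by (auto simp: r_coset_def)
    moreover have "h \<in> S" using incl \<open>h \<in> N\<close> by blast
    ultimately show ?thesis using subgroup.m_closed[OF S _ that(3)] by simp
  qed
  let ?U = "carrier (G Mod N) - (\<lambda>x. N #> x) ` S"
  have "N #> x \<in> ?U \<longleftrightarrow> x \<notin> S" if "x \<in> carrier G" for x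
    using saturated[OF that] that unfolding carrier_FactGroup by blast
  then have "{x \<in> topspace X. N #> x \<in> ?U} = topspace X - S"
    unfolding top by blast
  then have "openin ?Q ?U"
    using closed[OF S cS] by (simp add: openin_quotient_group_topology closedin_def)
  moreover have "D \<inter> ?U = {}"
  proof -
    have "d \<in> (\<lambda>x. N #> x) ` S" if d: "d \<in> D" for d
    proof -
      obtain x where x: "x \<in> carrier G" "d = N #> x" using coset[OF d] by blast
      then have "x \<in> S" using rcos_self[OF x(1) is_subgroup] incl d by blast
      then show ?thesis using x(2) by blast
    qed
    then show ?thesis by blast
  qed
  ultimately have "?U = {}" using dense unfolding dense_intersects_open by blast
  have "x \<in> S" if "x \<in> carrier G" for x
  proof -
    have "N #> x \<in> (\<lambda>x. N #> x) ` S" using \<open>?U = {}\<close> that unfolding carrier_FactGroup by blast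
    then obtain s where "N #> x = N #> s" "s \<in> S" by blast
    then show ?thesis by (rule saturated[OF that])
  qed
  then have "carrier G \<subseteq> S" by blast
  then have "countable (carrier G)" using cS by (rule countable_subset)
  with unc show False by contradiction
qed

lemma trivial_group_FactGroup_self:
  fixes G (structure)
  assumes "group G"
  shows "trivial_group (G Mod carrier G)"
proof -
  interpret group G by fact
  have n: "carrier G \<lhd> G"
    by (rule normal_invI[OF subgroup_self]) auto
  have "carrier G #> x = carrier G" if "x \<in> carrier G" for x
    using that subgroup_self coset_join2 by blast
  then have "carrier (G Mod carrier G) = {carrier G}"
    by (auto simp: carrier_FactGroup image_constant_conv)
  then show ?thesis
    unfolding trivial_group_def using normal.factorgroup_is_group[OF n] by (simp add: FactGroup_def)
qed

theorem theorem4p5: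
  shows "\<exists>A.
    subgroup A (torus (UNIV :: nat set set)) \<and> uncountable A \<and>
    dense_in A (torus_topology (UNIV :: nat set set)) \<and>
    (let G = (torus (UNIV :: nat set set))\<lparr>carrier := A\<rparr>;
         X = subtopology (torus_topology (UNIV :: nat set set)) A
     in (\<forall>S. subgroup S G \<and> countable S \<longrightarrow> h_embedded S G X \<and> closedin X S) \<and>
        (\<forall>S. subgroup S G \<and> uncountable S \<longrightarrow> dense_in S X) \<and>
        (\<forall>N. N \<lhd> G \<and> closedin X N \<longrightarrow>
           trivial_group (G Mod N) \<or> \<not> separable_space (quotient_group_topology G X N)))"
proof -
  obtain \<theta> :: "nat set \<Rightarrow> nat set \<Rightarrow> real" where "generic_angles \<theta>"
    using ex_generic_angles by blast
  then interpret generic_angles \<theta> .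
  have unc: "uncountable (range embedding)"
  proof (rule uncountable_range_embedding)
    show "uncountable (UNIV :: nat set set)"
      using Cantors_theorem[of "UNIV :: nat set"] unfolding countable_def
      by (metis Pow_UNIV countable_def range_from_nat_into UNIV_not_empty)
  qed
  have quot: "trivial_group (image_group Mod N) \<or> \<not> separable_space (quotient_group_topology image_group image_topology N)"
    if N: "N \<lhd> image_group" "closedin image_topology N" for N
  proof (cases "countable N")
    case True
    then show ?thesis
      using not_separable_quotient_by_countable[of image_topology image_group N]
        topspace_image_topology unc countable_subgroup_closed N(1) by simp
  next
    case False
    \<comment> \<open>An uncountable subgroup is dense, and a closed dense set is
      everything.\<close>
    then have "N = topspace image_topology"
      using uncountable_subgroup_dense_in_image[of N] N closure_of_closedin[OF N(2)]
      by (simp add: dense_in_def normal_imp_subgroup)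
    then have "N = carrier image_group" unfolding topspace_image_topology by simp
    then show ?thesis using trivial_group_FactGroup_self[OF group_image_group] by simp
  qed
  show ?thesis
    unfolding Let_def
    using subgroup_range_embedding unc uncountable_subgroup_dense[OF subgroup_range_embedding] quot
      countable_subgroup_h_embedded countable_subgroup_closed uncountable_subgroup_dense_in_image
    by (intro exI[of _ "range embedding"]) simp
qed

end
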